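(* Let $p<4$, $0<\alpha_1<\alpha_2<1$ and $D_7>1$ be given. Let $D=D_{FFP}(\alpha_1/D_7,\alpha_2/D_7)>0$ (the constant described in the context). There exist constants $D_1=D_1(\alpha_1,\alpha_2,p,D_7)>0$ and $\epsilon_1=\epsilon_1(\alpha_1,\alpha_2,p,D_7)\in(0,1)$ so that the following holds. Let $B\subset\mathbb{H}$ be a ball and suppose $E\subseteq\mathbb{H}$ is such that $$\beta_E(D_7B)=\frac{\epsilon}{D_7}\le\epsilon_1 .$$ Suppose $p_1,p_2,p_3\in E\cap B$ satisfy $\alpha_1\operatorname{diam}(B)\le d(p_i,p_j)\le\alpha_2\operatorname{diam}(B)$ for $i\ne j$ and $$d(p_1,p_2)+d(p_2,p_3)-d(p_1,p_3)=D\epsilon^q\operatorname{diam}(B)>D\epsilon^p\operatorname{diam}(B)$$ for some $q\in[2,p)$, and suppose that for every ball $B'\subseteq 4D_7B$ of diameter at least $\frac1{D_1}\epsilon^{q/2}\operatorname{diam}(B)$, the set $E\cap B'$ is $\frac1{D_1}\epsilon^{q/2}\operatorname{diam}(B)$-connected in $E\cap D_7B'$. Then there exists a ball $B''\subseteq16D_7B$ of diameter $$\operatorname{diam}(B'')\ge\frac1{D_1}\epsilon^{q/2}\operatorname{diam}(B)$$ so that $$d(p_1,p_2)+d(p_2,p_3)-d(p_1,p_3)\le D_1\,\beta_E(D_7B'')^p\operatorname{diam}(D_7B'')$$ and $$\beta_E(D_7B'')^p\le D_1\epsilon^{q/2}.$$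
   Context: The Heisenberg group is $\mathbb{H}=(\mathbb{R}^3,\cdot)$ with $(x,y,z)\cdot(x',y',z')=(x+x',\,y+y',\,z+z'+2(xy'-x'y))$. The Koranyi norm is $N(x,y,z)=((x^2+y^2)^2+z^2)^{1/4}$ and $d(g,h)=N(g^{-1}h)$ is the (left-invariant) Koranyi metric; all balls (closed), diameters and distances are with respect to $d$. For a ball $B$ and $\lambda>0$, $\lambda B$ is the ball with the same center and $\lambda$ times the radius. An element is horizontal if it is of the form $h=(h_1,h_2,0)$; put $\delta_t(h)=(th_1,th_2,0)$ for $t\in\mathbb{R}$. A horizontal line is a set $\{g\cdot\delta_t(h):t\in\mathbb{R}\}$ with $g\in\mathbb{H}$, $h\ne0$ horizontal. For $E\subseteq\mathbb{H}$ and a ball $B$, $\beta_E(B)=\inf_L\sup_{x\in E\cap B}d(x,L)/\operatorname{diam}(B)$, the infimum over all horizontal lines $L$ (supremum over the empty set is $0$). For $K\subseteq L$ subsets of $\mathbb{H}$ and $\delta>0$, $K$ is $\delta$-connected in $L$ if for all $x,y\in K$ there is a finite sequence $z_1,\dots,z_n\in L$ with $z_1=x$, $z_n=y$ and $d(z_i,z_{i+1})<\delta$ for all $i$. For $0<a_1<a_2<1$, $D_{FFP}(a_1,a_2)$ denotes a fixed finite positive constant, depending only on $a_1,a_2$, with the following property (such a constant is known to exist): for every ball $B\subset\mathbb{H}$, every $E\subseteq\mathbb{H}$ and all $p_1,p_2,p_3\in E\cap B$ with $a_1\operatorname{diam}(B)\le d(p_i,p_j)\le a_2\operatorname{diam}(B)$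 for $i\ne j$, labelled so that $d(p_1,p_3)$ is the largest of the three distances, one has $d(p_1,p_2)+d(p_2,p_3)-d(p_1,p_3)\le D_{FFP}(a_1,a_2)\,\beta_E(B)^2\operatorname{diam}(B)$. *)

theory Defs
  imports "HOL-Analysis.Analysis"
begin

text \<open>
  The Heisenberg group. Its (non-commutative) group law is written additively so that the type
  becomes an instance of \<^class>\<open>group_add\<close>: the product of g and h is g + h, the inverse
  of g is - g.
\<close>

datatype heis = Heis (hx: real) (hy: real) (hz: real)

instantiation heis :: group_add
begin

definition zero_heis :: heis where
  "0 = Heis 0 0 0"

definition plus_heis :: "heis \<Rightarrow> heis \<Rightarrow> heis" where
  "g + h = Heis (hx g + hx h) (hy g + hy h) (hz g + hz h + 2 * (hx g * hy h - hx h * hy g))"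

definition uminus_heis :: "heis \<Rightarrow> heis" where
  "- g = Heis (- hx g) (- hy g) (- hz g)"

definition minus_heis :: "heis \<Rightarrow> heis \<Rightarrow> heis" where
  "g - h = g + (- h)" for g h :: heis

instance
  by standard
    (auto simp: zero_heis_def plus_heis_def uminus_heis_def minus_heis_def algebra_simps)

end

definition koranyi_norm :: "heis \<Rightarrow> real" where
  "koranyi_norm g = root 4 (((hx g)\<^sup>2 + (hy g)\<^sup>2)\<^sup>2 + (hz g)\<^sup>2)"

lemma koranyi_norm_nonneg: "0 \<le> koranyi_norm g"
  by (simp add: koranyi_norm_def)

lemma koranyi_norm_power2:
  "(koranyi_norm g)\<^sup>2 = cmod (Complex ((hx g)\<^sup>2 + (hy g)\<^sup>2) (hz g))"
proof -
  have "((koranyi_norm g)\<^sup>2)\<^sup>2 = (koranyi_norm g) ^ 4"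
    by (simp flip: power_mult)
  also have "\<dots> = ((hx g)\<^sup>2 + (hy g)\<^sup>2)\<^sup>2 + (hz g)\<^sup>2"
    by (simp add: koranyi_norm_def)
  finally have "((koranyi_norm g)\<^sup>2)\<^sup>2 = ((hx g)\<^sup>2 + (hy g)\<^sup>2)\<^sup>2 + (hz g)\<^sup>2" .
  then show ?thesis
    by (metis cmod_def complex.sel real_sqrt_unique zero_le_power2)
qed

lemma koranyi_norm_eq_0_iff: "koranyi_norm g = 0 \<longleftrightarrow> g = 0"
  by (cases g) (auto simp: koranyi_norm_def zero_heis_def sum_power2_eq_zero_iff)

lemma koranyi_norm_minus: "koranyi_norm (- g) = koranyi_norm g"
  by (simp add: koranyi_norm_def uminus_heis_def)

lemma koranyi_norm_triangle: "koranyi_norm (g + h) \<le> koranyi_norm g + koranyi_norm h"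
proof -
  let ?N = koranyi_norm
  define u v where "u = Complex (hx g) (hy g)" and "v = Complex (hx h) (hy h)"
  have le: "cmod (Complex (hx k) (hy k)) \<le> ?N k" for k
  proof (rule power2_le_imp_le)
    have "(cmod (Complex (hx k) (hy k)))\<^sup>2 = \<bar>Re (Complex ((hx k)\<^sup>2 + (hy k)\<^sup>2) (hz k))\<bar>"
      by (simp add: cmod_power2)
    also have "\<dots> \<le> (?N k)\<^sup>2"
      unfolding koranyi_norm_power2 by (rule abs_Re_le_cmod)
    finally show "(cmod (Complex (hx k) (hy k)))\<^sup>2 \<le> (?N k)\<^sup>2" .
  qed (rule koranyi_norm_nonneg)
  have "Complex ((hx (g + h))\<^sup>2 + (hy (g + h))\<^sup>2) (hz (g + h)) =
      Complex ((hx g)\<^sup>2 + (hy g)\<^sup>2) (hz g) + Complex ((hx h)\<^sup>2 + (hy h)\<^sup>2) (hz h) + 2 * (cnj u * v)"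
    by (simp add: complex_eq_iff plus_heis_def u_def v_def power2_eq_square algebra_simps)
  then have "(?N (g + h))\<^sup>2 \<le> (?N g)\<^sup>2 + (?N h)\<^sup>2 + cmod (2 * (cnj u * v))"
    unfolding koranyi_norm_power2 by (metis norm_triangle_le norm_triangle_ineq add_right_mono)
  also have "cmod (2 * (cnj u * v)) = 2 * (cmod u * cmod v)"
    by (simp add: norm_mult)
  also have "\<dots> \<le> 2 * (?N g * ?N h)"
    using le[of g] le[of h] by (auto simp: u_def v_def intro!: mult_mono koranyi_norm_nonneg)
  finally have "(?N (g + h))\<^sup>2 \<le> (?N g + ?N h)\<^sup>2"
    by (simp add: power2_eq_square algebra_simps)
  then show ?thesis
    by (rule power2_le_imp_le) (simp add: koranyi_norm_nonneg)
qed

text \<open>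
  With the following instance, \<^const>\<open>cball\<close>, \<^const>\<open>diameter\<close> and
  \<^const>\<open>infdist\<close> on \<^typ>\<open>heis\<close> all refer to the Koranyi metric.
\<close>

instantiation heis :: metric_space
begin

definition dist_heis :: "heis \<Rightarrow> heis \<Rightarrow> real" where
  "dist g h = koranyi_norm (- g + h)"

definition uniformity_heis :: "(heis \<times> heis) filter" where
  "uniformity = (INF e\<in>{0 <..}. principal {(x::heis, y). dist x y < e})"

definition open_heis :: "heis set \<Rightarrow> bool" where
  "open U = (\<forall>x\<in>U. eventually (\<lambda>(x', y). x' = x \<longrightarrow> y \<in> U) uniformity)" for U :: "heis set"

instance
proof
  fix x y z :: heis
  show "dist x y = 0 \<longleftrightarrow> x = y"
    by (metis dist_heis_def koranyi_norm_eq_0_iff add.right_inverse minus_unique minus_minus)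
  have sym: "dist a b = dist b a" for a b :: heis
    using koranyi_norm_minus[of "- a + b"] by (simp add: dist_heis_def minus_add)
  have "- x + y = (- x + z) + (- z + y)"
    by (simp add: add.assoc)
  then have "dist x y \<le> dist x z + dist z y"
    by (metis dist_heis_def koranyi_norm_triangle)
  then show "dist x y \<le> dist x z + dist y z"
    by (simp add: sym[of z y])
qed (simp_all add: uniformity_heis_def open_heis_def)

end

definition horizontal :: "heis \<Rightarrow> bool" where
  "horizontal h \<longleftrightarrow> hz h = 0"

text \<open>Only used for horizontal elements.\<close>

definition hdilation :: "real \<Rightarrow> heis \<Rightarrow> heis" where
  "hdilation t h = Heis (t * hx h) (t * hy h) 0"

definition horizontal_line :: "heis set \<Rightarrow> bool" where
  "horizontal_line L \<longleftrightarrow> (\<exists>g h. horizontal h \<and> h \<noteq> 0 \<and> L = range (\<lambda>t. g + hdilation t h))"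

text \<open>
  The empty case is separate because the supremum of the empty set of reals is not specified
  to be 0.
\<close>

definition beta_number :: "heis set \<Rightarrow> heis set \<Rightarrow> real" where
  "beta_number E B =
    (INF L\<in>{L. horizontal_line L}.
      if E \<inter> B = {} then 0 else (SUP x\<in>E \<inter> B. infdist x L / diameter B))"

text \<open>Taking x = y shows that this forces K to be a subset of L.\<close>

definition delta_connected_in :: "real \<Rightarrow> heis set \<Rightarrow> heis set \<Rightarrow> bool" where
  "delta_connected_in \<delta> K L \<longleftrightarrow>
    (\<forall>x\<in>K. \<forall>y\<in>K. \<exists>zs. zs \<noteq> [] \<and> set zs \<subseteq> L \<and> hd zs = x \<and> last zs = y \<and>
      (\<forall>i. Suc i < length zs \<longrightarrow> dist (zs ! i) (zs ! Suc i) < \<delta>))"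

definition triangle_excess :: "heis \<Rightarrow> heis \<Rightarrow> heis \<Rightarrow> real" where
  "triangle_excess p1 p2 p3 = dist p1 p2 + dist p2 p3 - dist p1 p3"

definition distances_between :: "real \<Rightarrow> real \<Rightarrow> heis \<Rightarrow> heis \<Rightarrow> heis \<Rightarrow> bool" where
  "distances_between s t p1 p2 p3 \<longleftrightarrow>
    (\<forall>(u, v)\<in>{(p1, p2), (p2, p3), (p1, p3)}. s \<le> dist u v \<and> dist u v \<le> t)"

definition FFP_constant :: "real \<Rightarrow> real \<Rightarrow> real \<Rightarrow> bool" where
  "FFP_constant a1 a2 D \<longleftrightarrow> D > 0 \<and>
    (\<forall>c r E p1 p2 p3. r > 0 \<longrightarrow>
      (let B = cball c r in
        {p1, p2, p3} \<subseteq> E \<inter> B \<longrightarrow>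
        distances_between (a1 * diameter B) (a2 * diameter B) p1 p2 p3 \<longrightarrow>
        dist p1 p2 \<le> dist p1 p3 \<longrightarrow> dist p2 p3 \<le> dist p1 p3 \<longrightarrow>
        triangle_excess p1 p2 p3 \<le> D * (beta_number E B)\<^sup>2 * diameter B))"

end

theory Submission
  imports Defs
begin

text \<open>
  Write h for \<epsilon> powr (q / 2) and r for the radius of B, so that the triangle excess equals
  2 D h^2 r. Let L be a horizontal line at distance of order \<epsilon> r from E in the ball D7 B.

  Close to L the excess is at most of the order of y^2 / r + \<delta>^4 / r^3, where y bounds the deviation
  of the three points from L in the plane and \<delta> their distance from L
  (\<open>triangle_excess_near_line\<close>). Here \<delta> is of order \<epsilon> r and q < p < 4, so the second term is
  negligible. Hence the excess must be due to the planar deviation: one of the points has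
  y \<ge> \<kappa> h r for a constant \<kappa> that depends on D and \<alpha>1 only.

  The point is that the planar deviation is controlled by the squares of the beta numbers.
  Two horizontal lines that are both \<delta>-close to three points with mutual distances of order \<rho>
  have planar distance of order \<delta>^2 / \<rho> only, since the height of one line over the other is a
  quadratic polynomial whose coefficients are the tilt and the offset
  (\<open>across_le_across_nearby_line\<close>). The connectedness of E provides such points, at all
  scales above the length of the steps (\<open>connected_point_at_distance\<close>). Passing from L to the best
  line for the ball of radius \<rho> around one of the points, with \<rho> going down by factors 2 from the
  order of r to the order of h r / D1, shows that its planar deviation from L is at most of the order of
  the final radius plus the sum of all \<beta>^2 \<rho> (\<open>across_le_if_flat_scales\<close>).

  Suppose that no ball is as required. Then \<beta>^p \<rho> < D h^2 r / D1 at each of these scales, the other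
  requirement \<beta>^p \<le> D1 h being automatic because the beta number at most doubles from one
  scale to the next. Consequently \<beta>^2 \<rho> is at most (D h^2 r / D1) powr (2 / p) * \<rho> powr (1 - 2 / p). As
  p > 2, the sum is dominated by its first term, which is of order D1 powr (- 2 / p) h powr (4 / p) r; as
  p < 4, this is at most D1 powr (- 2 / p) h r. For large D1 both contributions are smaller than \<kappa> h r,
  a contradiction (\<open>across_le_if_no_good_ball\<close>).
\<close>

section \<open>Coordinates adapted to a horizontal line\<close>

lemma dist_heis_power4:
  "dist a b ^ 4 = ((hx b - hx a)\<^sup>2 + (hy b - hy a)\<^sup>2)\<^sup>2
    + (hz b - hz a - 2 * (hx a * hy b - hx b * hy a))\<^sup>2"
proof -
  have "dist a b ^ 4 = ((hx (- a + b))\<^sup>2 + (hy (- a + b))\<^sup>2)\<^sup>2 + (hz (- a + b))\<^sup>2"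
    by (simp add: dist_heis_def koranyi_norm_def)
  then show ?thesis
    by (simp add: plus_heis_def uminus_heis_def algebra_simps)
qed

definition unit_direction :: "heis \<Rightarrow> bool" where
  "unit_direction u \<longleftrightarrow> hz u = 0 \<and> (hx u)\<^sup>2 + (hy u)\<^sup>2 = 1"

text \<open>
  Coordinates adapted to the horizontal line through g in the direction u. The first two are the
  planar coordinates in the frame turned so that u is the first axis. The correction in the third
  one makes it the vertical displacement of w from the point of the line with the same first
  coordinate, so that all points of the line have across and height equal to 0.
\<close>

definition along :: "heis \<Rightarrow> heis \<Rightarrow> heis \<Rightarrow> real" where
  "along g u w = hx u * (hx w - hx g) + hy u * (hy w - hy g)"

definition across :: "heis \<Rightarrow> heis \<Rightarrow> heis \<Rightarrow> real" where
  "across g u w = hx u * (hy w - hy g) - hy u * (hx w - hx g)"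

definition height :: "heis \<Rightarrow> heis \<Rightarrow> heis \<Rightarrow> real" where
  "height g u w = hz w - hz g - 2 * (hx g * hy w - hx w * hy g) - 2 * along g u w * across g u w"

text \<open>
  A rotation preserves the planar part of the metric; the vertical part picks up the shear that
  comes from the correction term in the height. In this form a small across coordinate enters the
  distance only quadratically, up to the height difference.
\<close>

lemma dist_power4_adapted:
  assumes "unit_direction u"
  shows "dist a b ^ 4 =
    ((along g u b - along g u a)\<^sup>2 + (across g u b - across g u a)\<^sup>2)\<^sup>2
    + (height g u b - height g u a
       + 2 * (along g u b - along g u a) * (across g u a + across g u b))\<^sup>2"
proof -
  have u: "hx u * hx u + hy u * hy u = 1"
    using assms by (simp add: unit_direction_def power2_eq_square)
  have 1: "(along g u b - along g u a)\<^sup>2 + (across g u b - across g u a)\<^sup>2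
      = (hx b - hx a)\<^sup>2 + (hy b - hy a)\<^sup>2"
    using u unfolding along_def across_def by algebra
  have 2: "height g u b - height g u a
       + 2 * (along g u b - along g u a) * (across g u a + across g u b)
      = hz b - hz a - 2 * (hx a * hy b - hx b * hy a)"
    using u unfolding height_def along_def across_def by algebra
  show ?thesis
    by (simp only: dist_heis_power4 1 2)
qed

lemma line_point_adapted:
  assumes "unit_direction u"
  shows "along g u (g + hdilation t u) = t" and "across g u (g + hdilation t u) = 0"
    and "height g u (g + hdilation t u) = 0"
proof -
  have u: "hx u * hx u + hy u * hy u = 1"
    using assms by (simp add: unit_direction_def power2_eq_square)
  show "along g u (g + hdilation t u) = t"
    using u unfolding along_def plus_heis_def hdilation_def heis.sel by algebra
  show 2: "across g u (g + hdilation t u) = 0"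
    unfolding across_def plus_heis_def hdilation_def heis.sel by algebra
  show "height g u (g + hdilation t u) = 0"
    unfolding height_def 2 unfolding plus_heis_def hdilation_def heis.sel by algebra
qed

lemma adapted_bounds_near_line:
  assumes "unit_direction u" and "dist w (g + hdilation t u) \<le> \<delta>"
  shows "\<bar>along g u w - t\<bar> \<le> \<delta>" and "\<bar>across g u w\<bar> \<le> \<delta>" and "\<bar>height g u w\<bar> \<le> 3 * \<delta>\<^sup>2"
proof -
  define X Y Z where "X = along g u w - t" and "Y = across g u w" and "Z = height g u w"
  have \<delta>: "0 \<le> \<delta>"
    using assms(2) zero_le_dist order_trans by blast
  have "dist w (g + hdilation t u) ^ 4 \<le> \<delta> ^ 4"
    using assms(2) by (simp add: power_mono)
  moreover have "dist w (g + hdilation t u) ^ 4 = (X\<^sup>2 + Y\<^sup>2)\<^sup>2 + (Z + 2 * X * Y)\<^sup>2"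
    unfolding dist_power4_adapted[OF assms(1), where g = g] line_point_adapted[OF assms(1)]
      X_def Y_def Z_def by algebra
  ultimately have le: "(X\<^sup>2 + Y\<^sup>2)\<^sup>2 + (Z + 2 * X * Y)\<^sup>2 \<le> (\<delta>\<^sup>2)\<^sup>2"
    by simp
  have "(X\<^sup>2 + Y\<^sup>2)\<^sup>2 \<le> (\<delta>\<^sup>2)\<^sup>2"
    using le zero_le_power2[of "Z + 2 * X * Y"] by linarith
  then have XY: "X\<^sup>2 + Y\<^sup>2 \<le> \<delta>\<^sup>2"
    by (rule power2_le_imp_le) simp
  then have "X\<^sup>2 \<le> \<delta>\<^sup>2" "Y\<^sup>2 \<le> \<delta>\<^sup>2"
    using zero_le_power2[of X] zero_le_power2[of Y] by linarith+
  then show X: "\<bar>along g u w - t\<bar> \<le> \<delta>" and Y: "\<bar>across g u w\<bar> \<le> \<delta>"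
    using \<delta> abs_le_square_iff[of X \<delta>] abs_le_square_iff[of Y \<delta>] unfolding X_def Y_def by auto
  have "(Z + 2 * X * Y)\<^sup>2 \<le> (\<delta>\<^sup>2)\<^sup>2"
    using le zero_le_power2[of "X\<^sup>2 + Y\<^sup>2"] by linarith
  then have "\<bar>Z + 2 * X * Y\<bar> \<le> \<delta>\<^sup>2"
    using abs_le_square_iff[of "Z + 2 * X * Y" "\<delta>\<^sup>2"] by simp
  moreover have "\<bar>X * Y\<bar> \<le> \<delta> * \<delta>"
    unfolding abs_mult using X Y \<delta> by (intro mult_mono) (auto simp: X_def Y_def)
  ultimately show "\<bar>height g u w\<bar> \<le> 3 * \<delta>\<^sup>2"
    unfolding Z_def[symmetric] by (simp add: power2_eq_square)
qed

lemma dist_line_points: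
  assumes "unit_direction u"
  shows "dist (g + hdilation s u) (g + hdilation t u) = \<bar>s - t\<bar>"
proof -
  have "dist (g + hdilation s u) (g + hdilation t u) ^ 4 = \<bar>s - t\<bar> ^ 4"
    unfolding dist_power4_adapted[OF assms, where g = g] line_point_adapted[OF assms]
    by (simp flip: power_mult) algebra
  then show ?thesis
    by (rule power_eq_imp_eq_base) auto
qed

lemma line_rebase: "g + hdilation t u = (g + hdilation s u) + hdilation (t - s) u"
  by (simp add: plus_heis_def hdilation_def algebra_simps)

lemma across_rebase: "across (g + hdilation s u) u w = across g u w"
  by (simp add: across_def plus_heis_def hdilation_def algebra_simps)

text \<open>
  Horizontal lines are isometric copies of the real line, so the points at parameters r and -r of
  a horizontal line through the centre realize the diameter.
\<close>

lemma diameter_cball_heis: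
  fixes c :: heis
  assumes "0 \<le> r"
  shows "diameter (cball c r) = 2 * r"
proof (rule antisym)
  have "dist x y \<le> 2 * r" if "x \<in> cball c r" "y \<in> cball c r" for x y
    using that dist_triangle2[of x y c] by (simp add: dist_commute)
  then show "diameter (cball c r) \<le> 2 * r"
    using assms by (auto simp: diameter_def intro!: cSUP_least)
  define u where "u = Heis 1 0 0"
  have u: "unit_direction u"
    by (simp add: u_def unit_direction_def)
  have c: "c = c + hdilation 0 u"
    by (cases c) (simp add: plus_heis_def hdilation_def)
  have mem: "c + hdilation t u \<in> cball c r" if "\<bar>t\<bar> = r" for t
    using dist_line_points[OF u, of c 0 t] that c by simp
  have "dist (c + hdilation r u) (c + hdilation (- r) u) \<le> diameter (cball c r)"
    using assms by (intro diameter_bounded_bound mem) auto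
  then show "2 * r \<le> diameter (cball c r)"
    using assms by (simp add: dist_line_points[OF u])
qed

lemma horizontal_line_unit_direction:
  assumes "horizontal_line L"
  obtains g u where "unit_direction u" and "L = range (\<lambda>t. g + hdilation t u)"
proof -
  obtain g h where h: "horizontal h" "h \<noteq> 0" and L: "L = range (\<lambda>t. g + hdilation t h)"
    using assms by (auto simp: horizontal_line_def)
  define n where "n = sqrt ((hx h)\<^sup>2 + (hy h)\<^sup>2)"
  have "(hx h)\<^sup>2 + (hy h)\<^sup>2 \<noteq> 0"
    using h by (cases h) (auto simp: horizontal_def zero_heis_def sum_power2_eq_zero_iff)
  then have n: "n \<noteq> 0" "n\<^sup>2 = (hx h)\<^sup>2 + (hy h)\<^sup>2"
    by (auto simp: n_def)
  define u where "u = Heis (hx h / n) (hy h / n) 0"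
  have "unit_direction u"
    using n(1) by (simp add: unit_direction_def u_def power_divide n(2)[symmetric]
        flip: add_divide_distrib)
  moreover have "hdilation t h = hdilation (t * n) u" "hdilation t u = hdilation (t / n) h" for t
    using n by (simp_all add: hdilation_def u_def)
  then have "L = range (\<lambda>t. g + hdilation t u)"
    unfolding L by (metis (no_types, lifting) image_subset_iff rangeI subset_antisym)
  ultimately show ?thesis
    using that by blast
qed

lemma horizontal_line_range:
  assumes "unit_direction u"
  shows "horizontal_line (range (\<lambda>t. g + hdilation t u))"
  using assms unfolding horizontal_line_def unit_direction_def horizontal_def
  by (metis zero_neq_one heis.sel(1,2) zero_heis_def add_0 zero_power2)

section \<open>Beta numbers and approximating lines\<close>

definition near_line :: "real \<Rightarrow> heis \<Rightarrow> heis \<Rightarrow> heis \<Rightarrow> bool" where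
  "near_line \<delta> g u w \<longleftrightarrow> (\<exists>t. dist w (g + hdilation t u) \<le> \<delta>)"

lemma near_line_mono: "near_line \<delta> g u w \<Longrightarrow> \<delta> \<le> \<eta> \<Longrightarrow> near_line \<eta> g u w"
  unfolding near_line_def by (meson order_trans)

lemma near_line_if_infdist_less:
  assumes "infdist w (range (\<lambda>t. g + hdilation t u)) < \<delta>"
  shows "near_line \<delta> g u w"
proof -
  have "(INF v\<in>range (\<lambda>t. g + hdilation t u). dist w v) < \<delta>"
    using assms by (simp add: infdist_def)
  then have "\<exists>v\<in>range (\<lambda>t. g + hdilation t u). dist w v < \<delta>"
    by (subst (asm) cINF_less_iff) (auto intro: bdd_belowI[where m = 0])
  then show ?thesis
    unfolding near_line_def by (auto intro: less_imp_le)
qed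

lemma infdist_le_if_near_line:
  assumes "near_line \<delta> g u w"
  shows "infdist w (range (\<lambda>t. g + hdilation t u)) \<le> \<delta>"
  using assms unfolding near_line_def by (meson infdist_le2 rangeI)

definition relative_deviation :: "heis set \<Rightarrow> heis set \<Rightarrow> heis set \<Rightarrow> real" where
  "relative_deviation E B L = (if E \<inter> B = {} then 0 else (SUP x\<in>E \<inter> B. infdist x L / diameter B))"

lemma beta_number_eq_INF: "beta_number E B = (INF L\<in>{L. horizontal_line L}. relative_deviation E B L)"
  by (simp add: beta_number_def relative_deviation_def)

lemma infdist_le_relative_deviation:
  assumes "0 < r" and "w \<in> E \<inter> cball c r"
  shows "infdist w L / (2 * r) \<le> relative_deviation E (cball c r) L"
proof -
  have "infdist x L / diameter (cball c r) \<le> (infdist c L + r) / (2 * r)" if "x \<in> cball c r" for x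
  proof -
    have "infdist x L \<le> infdist c L + dist x c"
      by (rule infdist_triangle)
    then show ?thesis
      using that assms(1) by (auto simp: diameter_cball_heis dist_commute intro!: divide_right_mono)
  qed
  then have "bdd_above ((\<lambda>x. infdist x L / diameter (cball c r)) ` (E \<inter> cball c r))"
    by (intro bdd_aboveI[where M = "(infdist c L + r) / (2 * r)"]) auto
  then have "infdist w L / diameter (cball c r) \<le> (SUP x\<in>E \<inter> cball c r. infdist x L / diameter (cball c r))"
    using assms(2) by (intro cSUP_upper)
  then show ?thesis
    using assms by (auto simp: relative_deviation_def diameter_cball_heis)
qed

lemma relative_deviation_nonneg:
  assumes "0 < r"
  shows "0 \<le> relative_deviation E (cball c r) L"
proof (cases "E \<inter> cball c r = {}")
  case False
  then obtain w where w: "w \<in> E \<inter> cball c r" by blast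
  have "0 \<le> infdist w L / (2 * r)"
    using assms by (simp add: infdist_nonneg)
  then show ?thesis
    using infdist_le_relative_deviation[OF assms w] order_trans by blast
qed (simp add: relative_deviation_def)

lemma horizontal_lines_nonempty: "{L. horizontal_line L} \<noteq> {}"
proof -
  have "horizontal_line (range (\<lambda>t. 0 + hdilation t (Heis 1 0 0)))"
    by (rule horizontal_line_range) (simp add: unit_direction_def)
  then show ?thesis
    by blast
qed

lemma beta_number_nonneg: "0 < r \<Longrightarrow> 0 \<le> beta_number E (cball c r)"
  unfolding beta_number_eq_INF
  by (intro cINF_greatest horizontal_lines_nonempty relative_deviation_nonneg)

text \<open>
  The strict inequality leaves room on both levels, for a line that does not realize the infimum
  in the beta number and for a point of it that does not realize the distance.
\<close>

lemma beta_number_less_obtain_line: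
  assumes "0 < r" and "beta_number E (cball c r) < s"
  obtains g u where "unit_direction u"
    and "\<And>w. w \<in> E \<inter> cball c r \<Longrightarrow> near_line (2 * r * s) g u w"
proof -
  have "\<exists>L\<in>{L. horizontal_line L}. relative_deviation E (cball c r) L < s"
    using assms(2) horizontal_lines_nonempty relative_deviation_nonneg[OF assms(1)]
    unfolding beta_number_eq_INF by (subst (asm) cINF_less_iff) (auto intro!: bdd_belowI[where m = 0])
  then obtain L where L: "horizontal_line L" "relative_deviation E (cball c r) L < s"
    by blast
  obtain g u where gu: "unit_direction u" "L = range (\<lambda>t. g + hdilation t u)"
    using horizontal_line_unit_direction[OF L(1)] .
  have "near_line (2 * r * s) g u w" if w: "w \<in> E \<inter> cball c r" for w
  proof (rule near_line_if_infdist_less)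
    have "infdist w L / (2 * r) < s"
      using infdist_le_relative_deviation[OF assms(1) w] L(2) by (rule le_less_trans)
    then show "infdist w (range (\<lambda>t. g + hdilation t u)) < 2 * r * s"
      using assms(1) gu(2) by (simp add: divide_less_eq mult.commute)
  qed
  then show ?thesis
    using gu(1) that by blast
qed

lemma beta_number_le_if_near_line:
  assumes "0 < r" and "0 \<le> s" and "unit_direction u"
    and near: "\<And>w. w \<in> E \<inter> cball c r \<Longrightarrow> near_line (2 * r * s) g u w"
  shows "beta_number E (cball c r) \<le> s"
proof -
  let ?L = "range (\<lambda>t. g + hdilation t u)"
  have "beta_number E (cball c r) \<le> relative_deviation E (cball c r) ?L"
    unfolding beta_number_eq_INF
    using relative_deviation_nonneg[OF assms(1)] horizontal_line_range[OF assms(3)]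
    by (intro cINF_lower) (auto intro!: bdd_belowI[where m = 0])
  also have "\<dots> \<le> s"
  proof (cases "E \<inter> cball c r = {}")
    case False
    have "infdist x ?L / diameter (cball c r) \<le> s" if "x \<in> E \<inter> cball c r" for x
      using infdist_le_if_near_line[OF near[OF that]] assms(1)
      by (simp add: diameter_cball_heis divide_le_eq mult.commute)
    then show ?thesis
      using False by (auto simp: relative_deviation_def intro!: cSUP_least)
  qed (simp add: relative_deviation_def assms(2))
  finally show ?thesis .
qed

section \<open>Planar distance of two nearby horizontal lines\<close>

text \<open>
  Here \<sigma> and \<gamma> are the sine and the cosine of the planar angle between two horizontal
  lines. Along the second line the height relative to the first one is quadratic, with leading
  coefficient proportional to the tilt \<sigma>: a tilted or displaced horizontal line must leave the
  first one vertically. This is the trace of the non-commutativity on which the whole argument rests.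
\<close>

lemma line_in_adapted_coordinates:
  assumes "unit_direction u" and "unit_direction v"
  defines "\<sigma> \<equiv> across 0 u v" and "\<gamma> \<equiv> along 0 u v"
  shows "across g u (g' + hdilation t v) = across g u g' + t * \<sigma>"
    and "height g u (g' + hdilation t v)
      = height g u g' - 4 * \<gamma> * (across g u g' * t + \<sigma> * t\<^sup>2 / 2)"
    and "across g u w = across g u g' + along g' v w * \<sigma> + across g' v w * \<gamma>"
    and "\<gamma>\<^sup>2 + \<sigma>\<^sup>2 = 1"
proof -
  have u: "hx u * hx u + hy u * hy u = 1" and v: "hx v * hx v + hy v * hy v = 1"
    using assms by (simp_all add: unit_direction_def power2_eq_square)
  show "across g u (g' + hdilation t v) = across g u g' + t * \<sigma>"
    by (simp add: across_def plus_heis_def hdilation_def \<sigma>_def zero_heis_def algebra_simps)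
  have "2 * height g u (g' + hdilation t v)
      = 2 * height g u g' - 4 * \<gamma> * (across g u g' * t * 2 + \<sigma> * t\<^sup>2)"
    using u unfolding height_def across_def along_def plus_heis_def hdilation_def heis.sel \<sigma>_def \<gamma>_def zero_heis_def
    by algebra
  then show "height g u (g' + hdilation t v)
      = height g u g' - 4 * \<gamma> * (across g u g' * t + \<sigma> * t\<^sup>2 / 2)"
    by (simp add: algebra_simps)
  show "across g u w = across g u g' + along g' v w * \<sigma> + across g' v w * \<gamma>"
    using v unfolding across_def along_def \<sigma>_def \<gamma>_def zero_heis_def heis.sel by algebra
  show "\<gamma>\<^sup>2 + \<sigma>\<^sup>2 = 1"
    using u v unfolding across_def along_def \<sigma>_def \<gamma>_def zero_heis_def heis.sel by algebra
qed

text \<open>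
  A quadratic that is bounded at three well separated points has bounded coefficients. The planar
  bounds are too weak to give the conclusion; they only ensure that \<gamma> is not small, so that
  one may divide by it, and the bounds of order \<delta>^2 then come from the heights.
\<close>

lemma height_bounds_tilt_and_offset:
  fixes y0 z0 \<sigma> \<gamma> \<delta> \<rho> t1 t2 :: real
  assumes \<rho>: "0 < \<rho>" "100 * \<delta> \<le> \<rho>"
    and t: "\<rho> / 5 \<le> \<bar>t1\<bar>" "\<bar>t1\<bar> \<le> \<rho>" "\<rho> / 5 \<le> \<bar>t2\<bar>" "\<rho> / 5 \<le> \<bar>t1 - t2\<bar>"
    and unit: "\<gamma>\<^sup>2 + \<sigma>\<^sup>2 = 1"
    and y: "\<bar>y0\<bar> \<le> 2 * \<delta>" "\<bar>y0 + t1 * \<sigma>\<bar> \<le> 2 * \<delta>"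
    and z: "\<And>t. t \<in> {0, t1, t2} \<Longrightarrow> \<bar>z0 - 4 * \<gamma> * (y0 * t + \<sigma> * t\<^sup>2 / 2)\<bar> \<le> 12 * \<delta>\<^sup>2"
  shows "\<bar>\<sigma>\<bar> \<le> 1200 * \<delta>\<^sup>2 / \<rho>\<^sup>2" and "\<bar>y0\<bar> \<le> 660 * \<delta>\<^sup>2 / \<rho>"
proof -
  have "\<bar>t1\<bar> * \<bar>\<sigma>\<bar> \<le> 4 * \<delta>"
    using y by (simp flip: abs_mult)
  moreover have "\<rho> / 5 * \<bar>\<sigma>\<bar> \<le> \<bar>t1\<bar> * \<bar>\<sigma>\<bar>"
    using t(1) by (intro mult_right_mono) auto
  ultimately have "\<rho> * \<bar>\<sigma>\<bar> \<le> \<rho> * (1 / 5)"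
    using \<rho> by linarith
  then have "\<bar>\<sigma>\<bar> \<le> 1 / 5"
    using \<rho>(1) mult_le_cancel_left_pos by blast
  then have "\<sigma>\<^sup>2 \<le> (1 / 5)\<^sup>2"
    by (metis abs_ge_zero power2_abs power_mono)
  then have "(1 / 2)\<^sup>2 \<le> \<gamma>\<^sup>2"
    using unit by (simp add: power2_eq_square)
  then have \<gamma>: "1 / 2 \<le> \<bar>\<gamma>\<bar>"
    by (metis abs_ge_zero power2_abs power2_le_imp_le)
  have slope: "\<bar>y0 + \<sigma> * t / 2\<bar> \<le> 60 * \<delta>\<^sup>2 / \<rho>" if "t \<in> {t1, t2}" for t
  proof -
    have tt: "\<rho> / 5 \<le> \<bar>t\<bar>"
      using that t by auto
    have "\<bar>4 * \<gamma> * (y0 * t + \<sigma> * t\<^sup>2 / 2)\<bar> \<le> 24 * \<delta>\<^sup>2"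
      using z[of 0] z[of t] that by auto
    moreover have "4 * \<gamma> * (y0 * t + \<sigma> * t\<^sup>2 / 2) = 4 * (\<gamma> * (t * (y0 + \<sigma> * t / 2)))"
      by (simp add: power2_eq_square algebra_simps)
    ultimately have "\<bar>\<gamma>\<bar> * (\<bar>t\<bar> * \<bar>y0 + \<sigma> * t / 2\<bar>) \<le> 6 * \<delta>\<^sup>2"
      by (simp add: abs_mult)
    moreover have "1 / 2 * (\<rho> / 5 * \<bar>y0 + \<sigma> * t / 2\<bar>) \<le> \<bar>\<gamma>\<bar> * (\<bar>t\<bar> * \<bar>y0 + \<sigma> * t / 2\<bar>)"
      using tt \<gamma> \<rho> by (intro mult_mono mult_right_mono) auto
    ultimately show ?thesis
      using \<rho>(1) by (simp add: field_simps)
  qed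
  have "\<bar>\<sigma>\<bar> * \<bar>t1 - t2\<bar> / 2 \<le> 120 * \<delta>\<^sup>2 / \<rho>"
  proof -
    have "\<sigma> * (t1 - t2) / 2 = (y0 + \<sigma> * t1 / 2) - (y0 + \<sigma> * t2 / 2)"
      by (simp add: algebra_simps diff_divide_distrib)
    then have "\<bar>\<sigma> * (t1 - t2) / 2\<bar> \<le> 60 * \<delta>\<^sup>2 / \<rho> + 60 * \<delta>\<^sup>2 / \<rho>"
      using slope[of t1, OF insertI1] slope[of t2, simplified] by linarith
    then show ?thesis
      by (simp add: abs_mult)
  qed
  moreover have "\<bar>\<sigma>\<bar> * (\<rho> / 5) / 2 \<le> \<bar>\<sigma>\<bar> * \<bar>t1 - t2\<bar> / 2"
    using t by (intro divide_right_mono mult_left_mono) auto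
  ultimately have "\<bar>\<sigma>\<bar> * \<rho> \<le> 1200 * \<delta>\<^sup>2 / \<rho>"
    by linarith
  then show \<sigma>: "\<bar>\<sigma>\<bar> \<le> 1200 * \<delta>\<^sup>2 / \<rho>\<^sup>2"
    using \<rho>(1) by (simp add: field_simps power2_eq_square)
  have "\<bar>\<sigma> * t1\<bar> \<le> 1200 * \<delta>\<^sup>2 / \<rho>\<^sup>2 * \<rho>"
    unfolding abs_mult using \<sigma> t(2) \<rho> by (intro mult_mono) auto
  also have "\<dots> = 1200 * \<delta>\<^sup>2 / \<rho>"
    using \<rho>(1) by (simp add: power2_eq_square)
  finally show "\<bar>y0\<bar> \<le> 660 * \<delta>\<^sup>2 / \<rho>"
    using slope[of t1, OF insertI1] by linarith
qed

text \<open>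
  The two lines need only be \<delta>-close to three common points at mutual distances of order
  \<rho>, and yet their planar distance near p is of order \<delta>^2 / \<rho> instead of \<delta>: a
  larger gap or angle would separate them vertically, where a distance \<delta> allows a height of
  order \<delta>^2 only. So the planar deviation of p from a line changes by this much when
  the line is replaced by a nearby one.
\<close>

lemma across_le_across_nearby_line:
  assumes u: "unit_direction u" and v: "unit_direction v"
    and \<rho>: "0 < \<rho>" "100 * \<delta> \<le> \<rho>"
    and q1: "\<rho> / 3 \<le> dist p q1" "dist p q1 \<le> 5 * \<rho> / 12"
    and q2: "2 * \<rho> / 3 \<le> dist p q2"
    and near_u: "\<And>w. w \<in> {p, q1, q2} \<Longrightarrow> near_line \<delta> g u w"
    and near_v: "\<And>w. w \<in> {p, q1, q2} \<Longrightarrow> near_line \<delta> g' v w"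
  shows "\<bar>across g u p\<bar> \<le> \<bar>across g' v p\<bar> + 700 * \<delta>\<^sup>2 / \<rho>"
proof -
  obtain s0 s1 s2 where s: "dist p (g' + hdilation s0 v) \<le> \<delta>"
    "dist q1 (g' + hdilation s1 v) \<le> \<delta>" "dist q2 (g' + hdilation s2 v) \<le> \<delta>"
    using near_v[of p] near_v[of q1] near_v[of q2] unfolding near_line_def by auto
  have \<delta>: "0 \<le> \<delta>"
    using s(1) zero_le_dist order_trans by blast
  \<comment> \<open>The second line is parametrized from its point near p.\<close>
  define b where "b = g' + hdilation s0 v"
  define t1 t2 where "t1 = s1 - s0" and "t2 = s2 - s0"
  have rebase: "g' + hdilation t v = b + hdilation (t - s0) v" for t
    unfolding b_def by (rule line_rebase)
  have pts: "dist p (b + hdilation 0 v) \<le> \<delta>" "dist q1 (b + hdilation t1 v) \<le> \<delta>"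
    "dist q2 (b + hdilation t2 v) \<le> \<delta>"
    using s unfolding rebase by (simp_all add: t1_def t2_def)
  have t1: "dist (b + hdilation 0 v) (b + hdilation t1 v) = \<bar>t1\<bar>"
    and t2: "dist (b + hdilation 0 v) (b + hdilation t2 v) = \<bar>t2\<bar>"
    and t12: "dist (b + hdilation t1 v) (b + hdilation t2 v) = \<bar>t1 - t2\<bar>"
    by (simp_all add: dist_line_points[OF v])
  have perturb: "dist a c \<le> dist a' c' + 2 * \<delta> \<and> dist a' c' \<le> dist a c + 2 * \<delta>"
    if "dist a a' \<le> \<delta>" "dist c c' \<le> \<delta>" for a c a' c' :: heis
    using that dist_triangle[of a c a'] dist_triangle[of a' c c'] dist_triangle[of a' c' a]
      dist_triangle[of a c' c] dist_commute[of c c'] dist_commute[of a a'] by linarith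
  have q12: "dist q1 q2 \<ge> \<rho> / 4"
    using q1 q2 dist_triangle[of p q2 q1] by linarith
  have t: "\<rho> / 5 \<le> \<bar>t1\<bar>" "\<bar>t1\<bar> \<le> \<rho>" "\<rho> / 5 \<le> \<bar>t2\<bar>" "\<rho> / 5 \<le> \<bar>t1 - t2\<bar>"
    using perturb[OF pts(1,2), unfolded t1] perturb[OF pts(1,3), unfolded t2]
      perturb[OF pts(2,3), unfolded t12] q1 q2 q12 \<rho>
    by linarith+
  have near: "\<bar>across g u (b + hdilation t v)\<bar> \<le> 2 * \<delta> \<and> \<bar>height g u (b + hdilation t v)\<bar> \<le> 12 * \<delta>\<^sup>2"
    if t_cases: "t \<in> {0, t1, t2}" for t
  proof -
    obtain q where q: "q \<in> {p, q1, q2}" "dist q (b + hdilation t v) \<le> \<delta>"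
      using pts t_cases by auto
    then obtain a where "dist q (g + hdilation a u) \<le> \<delta>"
      using near_u unfolding near_line_def by blast
    then have "dist (b + hdilation t v) (g + hdilation a u) \<le> 2 * \<delta>"
      using q(2) dist_triangle[of "b + hdilation t v" "g + hdilation a u" q]
      by (simp add: dist_commute)
    from adapted_bounds_near_line[OF u this] show ?thesis
      by (simp add: power_mult_distrib)
  qed
  define \<sigma> \<gamma> where "\<sigma> = across 0 u v" and "\<gamma> = along 0 u v"
  note coords = line_in_adapted_coordinates(1-3)[OF u v, where g = g and g' = b, folded \<sigma>_def \<gamma>_def]
    line_in_adapted_coordinates(4)[OF u v, folded \<sigma>_def \<gamma>_def]
  have b0: "b + hdilation 0 v = b"
    by (cases b) (simp add: plus_heis_def hdilation_def)
  have "\<bar>\<sigma>\<bar> \<le> 1200 * \<delta>\<^sup>2 / \<rho>\<^sup>2 \<and> \<bar>across g u b\<bar> \<le> 660 * \<delta>\<^sup>2 / \<rho>"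
  proof (intro conjI)
    note near0 = near[of 0, unfolded b0] and near' = near[unfolded coords(1,2)]
    show "\<bar>\<sigma>\<bar> \<le> 1200 * \<delta>\<^sup>2 / \<rho>\<^sup>2"
      by (rule height_bounds_tilt_and_offset(1)[OF \<rho> t coords(4)]) (use near0 near' in auto)
    show "\<bar>across g u b\<bar> \<le> 660 * \<delta>\<^sup>2 / \<rho>"
      by (rule height_bounds_tilt_and_offset(2)[OF \<rho> t coords(4)]) (use near0 near' in auto)
  qed
  then have \<sigma>: "\<bar>\<sigma>\<bar> \<le> 1200 * \<delta>\<^sup>2 / \<rho>\<^sup>2" and y: "\<bar>across g u b\<bar> \<le> 660 * \<delta>\<^sup>2 / \<rho>"
    by auto
  have "\<bar>along b v p\<bar> \<le> \<delta>"
    using adapted_bounds_near_line(1)[OF v pts(1)] by simp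
  then have "\<bar>along b v p * \<sigma>\<bar> \<le> \<rho> / 100 * (1200 * \<delta>\<^sup>2 / \<rho>\<^sup>2)"
    unfolding abs_mult using \<sigma> \<rho> by (intro mult_mono) auto
  also have "\<dots> = 12 * \<delta>\<^sup>2 / \<rho>"
    using \<rho>(1) by (simp add: power2_eq_square)
  finally have tilt: "\<bar>along b v p * \<sigma>\<bar> \<le> 12 * \<delta>\<^sup>2 / \<rho>" .
  have "\<gamma>\<^sup>2 \<le> 1\<^sup>2"
    using coords(4) zero_le_power2[of \<sigma>] unfolding power_one by linarith
  then have "\<bar>\<gamma>\<bar> \<le> 1"
    by (metis abs_le_square_iff abs_one)
  then have "\<bar>across b v p * \<gamma>\<bar> \<le> \<bar>across b v p\<bar>"
    by (simp add: abs_mult mult_left_le)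
  moreover have "across b v p = across g' v p"
    by (simp add: b_def across_rebase)
  moreover have "0 \<le> \<delta>\<^sup>2 / \<rho>"
    using \<rho>(1) by simp
  ultimately show ?thesis
    using y tilt coords(3)[of p] by simp
qed

section \<open>The triangle excess near a horizontal line\<close>

text \<open>
  Near a line the distance is the length along the line, up to an error that is quadratic in the
  planar deviation y and of fourth order in \<delta>. The first inequality rules out that the
  distance is mostly vertical.
\<close>

lemma dist_bounds_near_line:
  assumes u: "unit_direction u" and a: "0 < a" "2 * a \<le> dist v w"
    and y: "8 * y \<le> a" "\<bar>across g u v\<bar> \<le> y" "\<bar>across g u w\<bar> \<le> y"
    and \<delta>: "0 \<le> \<delta>" "8 * \<delta> \<le> a" "\<bar>height g u v\<bar> \<le> 3 * \<delta>\<^sup>2" "\<bar>height g u w\<bar> \<le> 3 * \<delta>\<^sup>2"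
  defines "l \<equiv> \<bar>along g u v - along g u w\<bar>"
  shows "a \<le> l" and "l \<le> dist v w" and "dist v w \<le> l + (10 * y\<^sup>2 / a + 18 * \<delta> ^ 4 / a ^ 3)"
proof -
  define Y V where "Y = across g u w - across g u v"
    and "V = height g u w - height g u v
       + 2 * (along g u w - along g u v) * (across g u v + across g u w)"
  have d4: "dist v w ^ 4 = (l\<^sup>2 + Y\<^sup>2)\<^sup>2 + V\<^sup>2"
    unfolding dist_power4_adapted[OF u, where g = g] Y_def V_def l_def
    by (simp add: power2_commute)
  have l0: "0 \<le> l" by (simp add: l_def)
  have y0: "0 \<le> y" using y by linarith
  have "\<bar>Y\<bar> \<le> 2 * y"
    using y unfolding Y_def by linarith
  then have "\<bar>Y\<bar>\<^sup>2 \<le> (2 * y)\<^sup>2"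
    by (intro power_mono) auto
  then have Y: "Y\<^sup>2 \<le> 4 * y\<^sup>2"
    by (simp add: power_mult_distrib)
  have "\<bar>2 * (along g u w - along g u v) * (across g u v + across g u w)\<bar> \<le> 2 * l * (2 * y)"
    unfolding abs_mult using y by (intro mult_mono) (auto simp: l_def)
  then have V: "\<bar>V\<bar> \<le> 6 * \<delta>\<^sup>2 + 4 * (l * y)"
    using \<delta> unfolding V_def by linarith
  have "(l ^ 2)\<^sup>2 \<le> (l\<^sup>2 + Y\<^sup>2)\<^sup>2"
    by (intro power_mono) auto
  then have "l ^ 4 \<le> (l\<^sup>2 + Y\<^sup>2)\<^sup>2"
    by simp
  then have "l ^ 4 \<le> dist v w ^ 4"
    unfolding d4 using zero_le_power2[of V] by linarith
  then show "l \<le> dist v w"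
    by (rule power_le_imp_le_base[where n = 3, simplified]) simp
  show al: "a \<le> l"
  proof (rule ccontr)
    assume "\<not> a \<le> l"
    then have la: "l \<le> a" by simp
    have "l\<^sup>2 + Y\<^sup>2 \<le> a\<^sup>2 + 4 * (a / 8)\<^sup>2"
      using la l0 Y y y0 by (intro add_mono order_trans[OF Y] mult_left_mono power_mono) auto
    also have "\<dots> \<le> 2 * a\<^sup>2"
      by (simp add: power2_eq_square)
    finally have 1: "(l\<^sup>2 + Y\<^sup>2)\<^sup>2 \<le> (2 * a\<^sup>2)\<^sup>2"
      by (intro power_mono) auto
    have "6 * \<delta>\<^sup>2 + 4 * (l * y) \<le> 6 * (a / 8)\<^sup>2 + 4 * (a * (a / 8))"
      using la l0 y y0 \<delta> by (intro add_mono mult_left_mono power_mono mult_mono) auto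
    also have "\<dots> \<le> a\<^sup>2"
      by (simp add: power2_eq_square)
    finally have "\<bar>V\<bar>\<^sup>2 \<le> (a\<^sup>2)\<^sup>2"
      using V by (intro power_mono) auto
    then have "dist v w ^ 4 \<le> 5 * (a\<^sup>2)\<^sup>2"
      unfolding d4 using 1 by (simp add: power_mult_distrib)
    moreover have "(2 * a) ^ 4 \<le> dist v w ^ 4"
      using a by (intro power_mono) auto
    moreover have "(2 * a) ^ 4 = 16 * a ^ 4" and "(a\<^sup>2)\<^sup>2 = a ^ 4" and "0 < a ^ 4"
      using a by (simp_all add: power_mult_distrib)
    ultimately show False
      by linarith
  qed
  have lpos: "0 < l" using al a by simp
  \<comment> \<open>In the square of the distance the error is 2 l e, up to higher order: 4 y^2 is planar and
    the rest comes from the height.\<close>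
  define e where "e = 10 * y\<^sup>2 / l + 18 * \<delta> ^ 4 / l ^ 3"
  have e0: "0 \<le> e" using lpos by (simp add: e_def)
  have "V\<^sup>2 \<le> (6 * \<delta>\<^sup>2 + 4 * (l * y))\<^sup>2"
    using V by (metis abs_ge_zero power2_abs power_mono)
  also have "\<dots> \<le> 2 * (6 * \<delta>\<^sup>2)\<^sup>2 + 2 * (4 * (l * y))\<^sup>2"
    by (rule sum_squares_bound[of "6 * \<delta>\<^sup>2" "4 * (l * y)", THEN rev_mp]) (simp add: power2_eq_square algebra_simps)
  also have "\<dots> = 72 * \<delta> ^ 4 + 32 * l\<^sup>2 * y\<^sup>2"
    by (simp add: power_mult_distrib flip: power_mult)
  finally have V2: "V\<^sup>2 \<le> 72 * \<delta> ^ 4 + 32 * l\<^sup>2 * y\<^sup>2" .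
  have le: "2 * l * e = 20 * y\<^sup>2 + 36 * \<delta> ^ 4 / l\<^sup>2"
    using lpos by (simp add: e_def power2_eq_square power3_eq_cube field_simps)
  have square_sum: "(c + k)\<^sup>2 + 2 * c * f \<le> (c + k + f)\<^sup>2" if "0 \<le> k" "0 \<le> f" for c k f :: real
  proof -
    have "(c + k + f)\<^sup>2 = (c + k)\<^sup>2 + 2 * c * f + (2 * k * f + f\<^sup>2)"
      by (simp add: power2_eq_square algebra_simps)
    then show ?thesis
      using that by simp
  qed
  have "dist v w ^ 4 \<le> (l\<^sup>2 + 4 * y\<^sup>2)\<^sup>2 + V\<^sup>2"
    unfolding d4 using Y by (intro add_right_mono power_mono add_left_mono) auto
  also have "\<dots> \<le> (l\<^sup>2 + 4 * y\<^sup>2)\<^sup>2 + 2 * l\<^sup>2 * (16 * y\<^sup>2 + 36 * \<delta> ^ 4 / l\<^sup>2)"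
    using V2 lpos by (simp add: distrib_left)
  also have "\<dots> \<le> (l\<^sup>2 + 4 * y\<^sup>2 + (16 * y\<^sup>2 + 36 * \<delta> ^ 4 / l\<^sup>2))\<^sup>2"
    by (rule square_sum) auto
  also have "\<dots> = (l\<^sup>2 + 2 * l * e)\<^sup>2"
    by (rule arg_cong[where f = "\<lambda>x. x\<^sup>2"]) (use le in linarith)
  also have "\<dots> \<le> ((l + e)\<^sup>2)\<^sup>2"
    using lpos e0 by (intro power_mono) (auto simp: power2_eq_square algebra_simps)
  finally have "dist v w ^ 4 \<le> (l + e) ^ 4"
    by simp
  then have "dist v w \<le> l + e"
    by (rule power_le_imp_le_base[where n = 3, simplified]) (use lpos e0 in auto)
  moreover have "e \<le> 10 * y\<^sup>2 / a + 18 * \<delta> ^ 4 / a ^ 3"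
    unfolding e_def using al a \<delta> by (intro add_mono divide_left_mono power_mono mult_pos_pos) auto
  ultimately show "dist v w \<le> l + (10 * y\<^sup>2 / a + 18 * \<delta> ^ 4 / a ^ 3)"
    by simp
qed

text \<open>
  The excess of three points on a line vanishes if p2 lies between the other two, and is at least
  twice a distance if it does not. The hypothesis on the size of the excess excludes the second case,
  so only the errors of the distances remain.
\<close>

lemma triangle_excess_near_line:
  assumes u: "unit_direction u" and a: "0 < a" "8 * y \<le> a" "8 * \<delta> \<le> a"
    and near: "\<And>w. w \<in> {p1, p2, p3} \<Longrightarrow> near_line \<delta> g u w"
    and y: "\<And>w. w \<in> {p1, p2, p3} \<Longrightarrow> \<bar>across g u w\<bar> \<le> y"
    and far: "2 * a \<le> dist p1 p2" "2 * a \<le> dist p2 p3" "2 * a \<le> dist p1 p3"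
  defines "e \<equiv> 10 * y\<^sup>2 / a + 18 * \<delta> ^ 4 / a ^ 3"
  assumes small: "triangle_excess p1 p2 p3 + e < 2 * a"
  shows "triangle_excess p1 p2 p3 \<le> 2 * e"
proof -
  have \<delta>0: "0 \<le> \<delta>"
    using near[of p1] unfolding near_line_def by (meson insertCI order_trans zero_le_dist)
  have h: "\<bar>height g u w\<bar> \<le> 3 * \<delta>\<^sup>2" if "w \<in> {p1, p2, p3}" for w
    using near[OF that] adapted_bounds_near_line(3)[OF u] unfolding near_line_def by blast
  have *: "a \<le> \<bar>along g u v - along g u w\<bar> \<and> \<bar>along g u v - along g u w\<bar> \<le> dist v w
      \<and> dist v w \<le> \<bar>along g u v - along g u w\<bar> + e"
    if "2 * a \<le> dist v w" "v \<in> {p1, p2, p3}" "w \<in> {p1, p2, p3}" for v w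
    using dist_bounds_near_line[OF u a(1) that(1) a(2) y[OF that(2)] y[OF that(3)] \<delta>0 a(3)
        h[OF that(2)] h[OF that(3)]] unfolding e_def by blast
  have "a \<le> \<bar>along g u p1 - along g u p2\<bar> \<and> \<bar>along g u p1 - along g u p2\<bar> \<le> dist p1 p2
      \<and> dist p1 p2 \<le> \<bar>along g u p1 - along g u p2\<bar> + e"
    and "a \<le> \<bar>along g u p2 - along g u p3\<bar> \<and> \<bar>along g u p2 - along g u p3\<bar> \<le> dist p2 p3
      \<and> dist p2 p3 \<le> \<bar>along g u p2 - along g u p3\<bar> + e"
    and "\<bar>along g u p1 - along g u p3\<bar> \<le> dist p1 p3"
    and "dist p1 p3 \<le> \<bar>along g u p1 - along g u p3\<bar> + e"
    using far * by simp_all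
  then show ?thesis
    using small unfolding triangle_excess_def by linarith
qed

section \<open>Planar deviation across the scales\<close>

text \<open>
  A discrete intermediate value theorem: along a chain from x to y the distance from x grows by
  less than \<eta> in each step, so the first point of the chain at distance at least s will do.
\<close>

lemma connected_point_at_distance:
  assumes conn: "delta_connected_in \<eta> K L" and "x \<in> K" "y \<in> K" and s: "0 < s" "s \<le> dist x y"
  obtains w where "w \<in> L" "s \<le> dist x w" "dist x w < s + \<eta>"
proof -
  obtain zs where zs: "zs \<noteq> []" "set zs \<subseteq> L" "hd zs = x" "last zs = y"
    and step: "\<And>i. Suc i < length zs \<Longrightarrow> dist (zs ! i) (zs ! Suc i) < \<eta>"
    using conn assms(2,3) unfolding delta_connected_in_def by blast
  define i where "i = (LEAST i. i < length zs \<and> s \<le> dist x (zs ! i))"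
  have "length zs - 1 < length zs \<and> s \<le> dist x (zs ! (length zs - 1))"
    using zs s by (simp add: last_conv_nth)
  then have i: "i < length zs \<and> s \<le> dist x (zs ! i)"
    unfolding i_def by (rule LeastI)
  have "i \<noteq> 0"
    using i zs s by (metis dist_self hd_conv_nth not_le)
  then obtain j where j: "i = Suc j"
    using not0_implies_Suc by blast
  then have "\<not> (j < length zs \<and> s \<le> dist x (zs ! j))"
    unfolding i_def by (intro not_less_Least) simp
  then have "dist x (zs ! j) < s"
    using i j by simp
  moreover have "dist (zs ! j) (zs ! i) < \<eta>"
    using step i j by simp
  ultimately have "dist x (zs ! i) < s + \<eta>"
    using dist_triangle[of x "zs ! i" "zs ! j"] by simp
  then show ?thesis
    using that i zs(2) by (meson nth_mem subsetD)
qed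

text \<open>
  Descend from radius \<rho>0 to \<rho>0 / 2 ^ n around x, replacing the approximating line at each
  scale. At radius \<rho> the beta number is at most b * \<omega> ^ k, so the change of line costs
  a planar deviation of the order of the square of this number times \<rho>. Since
  \<omega>^2 < 2 these costs form a decreasing geometric series, and the largest scale dominates.
  The implication in the last hypothesis makes it possible to obtain the flatness at one scale from
  the flatness at the scale before, because halving the radius at most doubles the beta number.
\<close>

lemma across_le_if_flat_scales:
  assumes u: "unit_direction u"
    and \<rho>0: "0 < \<rho>0" and b: "0 \<le> b" "400 * (b * \<omega> ^ n) \<le> 1" and \<omega>: "1 \<le> \<omega>" "\<omega>\<^sup>2 < 2"
    and x: "x \<in> E"
    and reach: "\<And>s. 0 < s \<Longrightarrow> s \<le> \<rho>0 \<Longrightarrow> \<exists>w\<in>E. s \<le> dist x w \<and> dist x w < s + \<eta>"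
    and \<eta>: "12 * \<eta> \<le> \<rho>0 / 2 ^ n"
    and near: "\<And>w. w \<in> E \<inter> cball x \<rho>0 \<Longrightarrow> near_line (2 * \<rho>0 * b) g u w"
    and flat: "\<And>k. k < n \<Longrightarrow> beta_number E (cball x (\<rho>0 / 2 ^ Suc k)) \<le> 2 * (b * \<omega> ^ k) \<Longrightarrow>
      beta_number E (cball x (\<rho>0 / 2 ^ Suc k)) < b * \<omega> ^ Suc k"
  shows "\<bar>across g u x\<bar> \<le> \<rho>0 / 2 ^ n + 5600 * \<rho>0 * b\<^sup>2 / (1 - \<omega>\<^sup>2 / 2)"
proof -
  define \<rho> where "\<rho> k = \<rho>0 / 2 ^ k" for k :: nat
  have \<rho>: "0 < \<rho> k" "\<rho> k \<le> \<rho>0" "\<rho> k = 2 * \<rho> (Suc k)" for k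
    using \<rho>0 by (simp_all add: \<rho>_def field_simps)
  have \<rho>_mono: "\<rho> n \<le> \<rho> k" if "k \<le> n" for k
    using that \<rho>0 unfolding \<rho>_def by (intro divide_left_mono power_increasing) auto
  have \<omega>2: "\<omega> \<le> 2"
  proof (rule ccontr)
    assume "\<not> \<omega> \<le> 2"
    then have "2\<^sup>2 \<le> \<omega>\<^sup>2"
      by (intro power_mono) auto
    then show False
      using \<omega>(2) by simp
  qed
  have "\<exists>g' v. unit_direction v
      \<and> (\<forall>w\<in>E \<inter> cball x (\<rho> k). near_line (2 * \<rho> k * (b * \<omega> ^ k)) g' v w)
      \<and> \<bar>across g u x\<bar> \<le> \<bar>across g' v x\<bar> + 5600 * \<rho>0 * b\<^sup>2 * (\<Sum>j<k. (\<omega>\<^sup>2 / 2) ^ j)"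
    if "k \<le> n" for k
    using that
  proof (induction k)
    case 0
    show ?case
      using u near by (intro exI[of _ g] exI[of _ u]) (auto simp: \<rho>_def)
  next
    case (Suc k)
    from Suc.IH[OF Suc_leD[OF Suc.prems]] obtain g' v where v: "unit_direction v"
      and near_v: "\<forall>w\<in>E \<inter> cball x (\<rho> k). near_line (2 * \<rho> k * (b * \<omega> ^ k)) g' v w"
      and IH: "\<bar>across g u x\<bar> \<le> \<bar>across g' v x\<bar> + 5600 * \<rho>0 * b\<^sup>2 * (\<Sum>j<k. (\<omega>\<^sup>2 / 2) ^ j)"
      by blast
    define \<delta> where "\<delta> = 2 * \<rho> k * (b * \<omega> ^ k)"
    have \<delta>: "\<delta> = 2 * \<rho> (Suc k) * (2 * (b * \<omega> ^ k))"
      by (simp add: \<delta>_def \<rho>(3)[of k])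
    have B0: "0 \<le> b * \<omega> ^ k"
      using b \<omega> by simp
    have sub: "w \<in> E \<inter> cball x (\<rho> k)" if "w \<in> E \<inter> cball x (\<rho> (Suc k))" for w
      using that \<rho>(1)[of "Suc k"] unfolding \<rho>(3)[of k] by auto
    have "beta_number E (cball x (\<rho> (Suc k))) \<le> 2 * (b * \<omega> ^ k)"
      by (rule beta_number_le_if_near_line[OF \<rho>(1) _ v])
        (use B0 near_v[rule_format, OF sub] in \<open>auto simp: \<delta>_def[symmetric] \<delta>[symmetric]\<close>)
    then have "beta_number E (cball x (\<rho> (Suc k))) < b * \<omega> ^ Suc k"
      using flat[of k] Suc.prems by (simp add: \<rho>_def)
    from beta_number_less_obtain_line[OF \<rho>(1) this] obtain g'' v' where v': "unit_direction v'"
      and near_v': "\<And>w. w \<in> E \<inter> cball x (\<rho> (Suc k)) \<Longrightarrow>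
        near_line (2 * \<rho> (Suc k) * (b * \<omega> ^ Suc k)) g'' v' w"
      by blast
    have "2 * \<rho> (Suc k) * (b * \<omega> ^ Suc k) \<le> \<delta>"
    proof -
      have "2 * \<rho> (Suc k) * (b * \<omega> ^ k * \<omega>) \<le> 2 * \<rho> (Suc k) * (b * \<omega> ^ k * 2)"
        using B0 \<omega>2 \<rho>(1)[of "Suc k"] by (intro mult_left_mono) auto
      then show ?thesis
        by (simp add: \<delta> mult_ac)
    qed
    note near_v'_\<delta> = near_line_mono[OF near_v' this]
    have small: "100 * \<delta> \<le> \<rho> (Suc k)"
    proof -
      have "b * \<omega> ^ k \<le> b * \<omega> ^ n"
        using Suc.prems b \<omega> by (intro mult_left_mono power_increasing) auto
      then have "\<rho> (Suc k) * (400 * (b * \<omega> ^ k)) \<le> \<rho> (Suc k) * 1"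
        using b \<rho>(1)[of "Suc k"] by (intro mult_left_mono) auto
      then show ?thesis
        by (simp add: \<delta>)
    qed
    have \<eta>': "12 * \<eta> \<le> \<rho> (Suc k)"
      using \<eta> \<rho>_mono[OF Suc.prems] by (simp add: \<rho>_def)
    \<comment> \<open>Together with x these are the three separated points that fix the lines.\<close>
    obtain q1 where q1: "q1 \<in> E" "\<rho> (Suc k) / 3 \<le> dist x q1" "dist x q1 < \<rho> (Suc k) / 3 + \<eta>"
      using reach[of "\<rho> (Suc k) / 3"] \<rho>(1,2)[of "Suc k"] by auto
    obtain q2 where q2: "q2 \<in> E" "2 * \<rho> (Suc k) / 3 \<le> dist x q2" "dist x q2 < 2 * \<rho> (Suc k) / 3 + \<eta>"
      using reach[of "2 * \<rho> (Suc k) / 3"] \<rho>(1,2)[of "Suc k"] by auto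
    have mem: "w \<in> E \<inter> cball x (\<rho> (Suc k))" if "w \<in> {x, q1, q2}" for w
      using that x q1 q2 \<eta>' \<rho>(1)[of "Suc k"] by auto
    have "\<bar>across g' v x\<bar> \<le> \<bar>across g'' v' x\<bar> + 700 * \<delta>\<^sup>2 / \<rho> (Suc k)"
    proof (rule across_le_across_nearby_line[OF v v' \<rho>(1) small q1(2) _ q2(2)])
      show "dist x q1 \<le> 5 * \<rho> (Suc k) / 12"
        using q1(3) \<eta>' by linarith
      show "near_line \<delta> g' v w" "near_line \<delta> g'' v' w" if "w \<in> {x, q1, q2}" for w
        using near_v[rule_format, OF sub[OF mem[OF that]]] near_v'_\<delta>[OF mem[OF that]] by (simp_all add: \<delta>_def)
    qed
    also have "700 * \<delta>\<^sup>2 / \<rho> (Suc k) = 5600 * \<rho>0 * b\<^sup>2 * (\<omega>\<^sup>2 / 2) ^ k"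
    proof -
      have "700 * \<delta>\<^sup>2 / \<rho> (Suc k) = 5600 * \<rho> k * b\<^sup>2 * (\<omega> ^ k)\<^sup>2"
        using \<rho>(1)[of "Suc k"]
        by (simp add: \<delta> \<rho>(3)[of k] power_mult_distrib) (simp add: power2_eq_square)
      also have "\<dots> = 5600 * \<rho>0 * b\<^sup>2 * (\<omega>\<^sup>2 / 2) ^ k"
        by (simp add: \<rho>_def power_divide power_mult[symmetric] mult.commute[of k])
      finally show ?thesis .
    qed
    finally have "\<bar>across g u x\<bar> \<le> \<bar>across g'' v' x\<bar> + 5600 * \<rho>0 * b\<^sup>2 * (\<Sum>j<Suc k. (\<omega>\<^sup>2 / 2) ^ j)"
      using IH by (simp add: distrib_left)
    then show ?case
      using v' near_v' by blast
  qed
  from this[of n] obtain g' v where v: "unit_direction v"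
    and near_v: "\<forall>w\<in>E \<inter> cball x (\<rho> n). near_line (2 * \<rho> n * (b * \<omega> ^ n)) g' v w"
    and dev: "\<bar>across g u x\<bar> \<le> \<bar>across g' v x\<bar> + 5600 * \<rho>0 * b\<^sup>2 * (\<Sum>j<n. (\<omega>\<^sup>2 / 2) ^ j)"
    by blast
  have "near_line (2 * \<rho> n * (b * \<omega> ^ n)) g' v x"
    using near_v x \<rho>(1)[of n] by simp
  then have "\<bar>across g' v x\<bar> \<le> 2 * \<rho> n * (b * \<omega> ^ n)"
    using adapted_bounds_near_line(2)[OF v] unfolding near_line_def by blast
  also have "\<dots> \<le> \<rho> n"
    using mult_left_mono[OF b(2), of "\<rho> n"] \<rho>(1)[of n] b \<omega> by simp
  finally have 1: "\<bar>across g' v x\<bar> \<le> \<rho> n" .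
  have geometric: "(\<Sum>j<n. (\<omega>\<^sup>2 / 2) ^ j) \<le> 1 / (1 - \<omega>\<^sup>2 / 2)"
  proof -
    have "(1 - \<omega>\<^sup>2 / 2) * (\<Sum>j<n. (\<omega>\<^sup>2 / 2) ^ j) = 1 - (\<omega>\<^sup>2 / 2) ^ n"
      by (rule one_diff_power_eq[symmetric])
    also have "\<dots> \<le> 1"
      by simp
    finally show ?thesis
      using \<omega> by (simp add: le_divide_eq mult.commute)
  qed
  have "5600 * \<rho>0 * b\<^sup>2 * (\<Sum>j<n. (\<omega>\<^sup>2 / 2) ^ j) \<le> 5600 * \<rho>0 * b\<^sup>2 * (1 / (1 - \<omega>\<^sup>2 / 2))"
    using geometric \<rho>0 by (intro mult_left_mono) auto
  then show ?thesis
    using dev 1 by (simp add: \<rho>_def)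
qed

section \<open>Choice of the constants and the scales\<close>

lemma exists_large_constant:
  fixes C1 C2 a d \<theta> \<kappa> :: real
  assumes "0 < \<kappa>" "0 < \<theta>" "0 < a"
  shows "\<exists>D1. 1 \<le> D1 \<and> d \<le> D1 \<and> C1 / D1 + C2 * (a / D1) powr \<theta> \<le> \<kappa>"
proof -
  have inv: "((\<lambda>x. a / x) \<longlongrightarrow> 0) at_top" "((\<lambda>x. C1 / x) \<longlongrightarrow> 0) at_top"
    by (rule real_tendsto_divide_at_top[OF tendsto_const filterlim_ident])+
  have "eventually (\<lambda>x. 0 \<le> a / x) at_top"
    using eventually_gt_at_top[of 0] by eventually_elim (use assms(3) in simp)
  then have "((\<lambda>x. (a / x) powr \<theta>) \<longlongrightarrow> 0) at_top"
    using assms(2) by (rule tendsto_zero_powrI[OF inv(1) tendsto_const])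
  then have "((\<lambda>x. C1 / x + C2 * (a / x) powr \<theta>) \<longlongrightarrow> 0 + C2 * 0) at_top"
    by (intro tendsto_intros inv)
  then have "eventually (\<lambda>x. C1 / x + C2 * (a / x) powr \<theta> < \<kappa>) at_top"
    by (rule order_tendstoD(2)) (use assms(1) in simp)
  then have "eventually (\<lambda>x. C1 / x + C2 * (a / x) powr \<theta> < \<kappa> \<and> 1 \<le> x \<and> d \<le> x) at_top"
    by (intro eventually_conj eventually_ge_at_top)
  then show ?thesis
    using eventually_happens'[OF trivial_limit_at_top_linorder] less_imp_le by blast
qed

lemma exists_small_bound:
  fixes \<theta> c d :: real
  assumes "0 < \<theta>" "0 < c" "0 < d"
  shows "\<exists>e. 0 < e \<and> e < 1 \<and> e \<le> c \<and> e powr \<theta> \<le> d"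
proof -
  define e where "e = min (min (1 / 2) c) (d powr (1 / \<theta>))"
  have "0 < e" "e \<le> 1 / 2" "e \<le> c"
    using assms by (auto simp: e_def)
  moreover have "e powr \<theta> \<le> (d powr (1 / \<theta>)) powr \<theta>"
    using assms \<open>0 < e\<close> by (intro powr_mono2) (auto simp: e_def)
  then have "e powr \<theta> \<le> d"
    using assms by (simp add: powr_powr)
  ultimately show ?thesis
    by (intro exI[of _ e]) auto
qed

lemma exists_dyadic_scale:
  fixes T \<rho>0 :: real
  assumes "0 < T" "T \<le> \<rho>0"
  shows "\<exists>n. T \<le> \<rho>0 / 2 ^ n \<and> \<rho>0 / 2 ^ n < 2 * T"
proof -
  have "eventually (\<lambda>n. \<rho>0 / 2 ^ n < T) sequentially"
    by (rule order_tendstoD(2)[OF LIMSEQ_divide_realpow_zero]) (use assms(1) in auto)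
  then have ex: "\<exists>n. \<rho>0 / 2 ^ n < T"
    using eventually_happens'[OF sequentially_bot] by blast
  define m where "m = (LEAST n. \<rho>0 / 2 ^ n < T)"
  have m: "\<rho>0 / 2 ^ m < T"
    unfolding m_def using ex by (rule LeastI_ex)
  then have "m \<noteq> 0"
    using assms by (intro notI) simp
  then obtain n where n: "m = Suc n"
    using not0_implies_Suc by blast
  then have "\<not> \<rho>0 / 2 ^ n < T"
    unfolding m_def by (intro not_less_Least) simp
  then show ?thesis
    using m n by (intro exI[of _ n]) auto
qed

text \<open>
  If no ball is good, then \<beta>^p \<rho> < D h^2 r / D1 for the balls of radius \<rho> around x,
  as long as \<rho> is at least K h r / D1. So the beta numbers grow at most like
  \<rho> powr (- 1 / p), and the costs \<beta>^2 \<rho> of the changes of line are summable as p > 2.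
  Their sum is of the order of (h^2 / D1) powr (2 / p) r, which is at most D1 powr (- 2 / p) h r as
  p \<le> 4.

  In M the factors besides D allow for the first scale, where the line u and the estimate for
  \<epsilon> take the place of a bad ball. In K, the number 24 makes the steps of the chains short compared
  with the smallest radius, D7 makes the balls large enough to be candidates for a good ball,
  and the last term makes the beta numbers at most 1 / 400.
\<close>

lemma across_le_if_no_good_ball:
  fixes x :: heis and \<epsilon> h :: real
  assumes p: "2 < p" and p4: "p \<le> 4" and D: "0 < D" and D7: "1 < D7" and D1: "1 \<le> D1" and r: "0 < r"
    and \<mu>: "0 < \<mu>" "\<mu> \<le> 1" "\<mu> \<le> D7 - 1"
    and h: "0 < h" "h \<le> 1"
  defines "M \<equiv> D * D7 powr p * (2 / \<mu>) powr p"
  defines "K \<equiv> 24 + D7 + M * 400 powr p"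
  assumes K: "K / \<mu> \<le> D1"
    and x: "x \<in> E" "dist c x \<le> r"
    and reach: "\<And>s. 0 < s \<Longrightarrow> s \<le> \<mu> * r \<Longrightarrow> \<exists>w\<in>E. s \<le> dist x w \<and> dist x w < s + 2 * h * r / D1"
    and \<epsilon>: "0 < \<epsilon>" "D1 * \<epsilon> powr p < D * h\<^sup>2 * D7 powr p"
    and u: "unit_direction u"
    and near: "\<And>w. w \<in> E \<inter> cball c (D7 * r) \<Longrightarrow> near_line (4 * \<epsilon> * r) g u w"
    and no_good_ball: "\<And>c' s. 0 < s \<Longrightarrow> cball c' s \<subseteq> cball c (16 * D7 * r) \<Longrightarrow> h * r / D1 \<le> s \<Longrightarrow>
      beta_number E (cball c' (D7 * s)) powr p \<le> D1 * h \<Longrightarrow>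
      D1 * beta_number E (cball c' (D7 * s)) powr p * (D7 * s) < D * h\<^sup>2 * r"
  shows "\<bar>across g u x\<bar>
    \<le> (2 * K / D1 + 5600 / (1 - (2 powr (1 / p))\<^sup>2 / 2) * (M / \<mu> / D1) powr (2 / p)) * h * r"
proof -
  define \<omega> :: real where "\<omega> = 2 powr (1 / p)"
  \<comment> \<open>The number b \<omega>^k is the solution \<beta> of \<beta>^p \<rho> = M h^2 r / D1 for \<rho> = \<mu> r / 2^k.\<close>
  define b where "b = (M * h\<^sup>2 / (D1 * \<mu>)) powr (1 / p)"
  define \<rho>0 where "\<rho>0 = \<mu> * r"
  have p0: "0 < p" using p by simp
  have "1 \<le> D7 powr p" "1 \<le> (2 / \<mu>) powr p"
    using D7 \<mu> p by (auto intro!: ge_one_powr_ge_zero simp: field_simps)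
  then have "D * 1 * 1 \<le> M"
    unfolding M_def using D by (intro mult_mono) auto
  then have M: "D \<le> M" "0 < M"
    using D by auto
  have K0: "0 < K" "24 \<le> K" "D7 \<le> K" "M * 400 powr p \<le> K"
    using M D7 by (auto simp: K_def intro: add_nonneg_pos)
  have \<rho>0: "0 < \<rho>0"
    using \<mu> r by (simp add: \<rho>0_def)
  \<comment> \<open>The scales end at the threshold T, where the trivial bound \<rho> for the deviation is already
    small compared with h r.\<close>
  define T where "T = K * h * r / D1"
  have T: "0 < T"
    using K0 h r D1 by (simp add: T_def)
  have "T \<le> \<rho>0"
  proof -
    have "K * h \<le> K"
      using K0 h by simp
    also have "K \<le> D1 * \<mu>"
      using K \<mu> by (simp add: divide_le_eq)
    finally have "K * h \<le> D1 * \<mu>" .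
    then show ?thesis
      using D1 r by (simp add: T_def \<rho>0_def field_simps)
  qed
  from exists_dyadic_scale[OF T this] obtain n where n: "T \<le> \<rho>0 / 2 ^ n" "\<rho>0 / 2 ^ n < 2 * T"
    by blast
  have \<omega>_powr: "\<omega> powr p = 2"
    using p0 by (simp add: \<omega>_def powr_powr)
  have \<omega>1: "1 \<le> \<omega>"
    using p0 by (simp add: \<omega>_def ge_one_powr_ge_zero)
  have "\<omega>\<^sup>2 = 2 powr (2 / p)"
    by (simp add: \<omega>_def powr_power)
  also have "\<dots> < 2 powr 1"
    using p by (intro powr_less_mono) auto
  finally have \<omega>2: "\<omega>\<^sup>2 < 2"
    by simp
  have b0: "0 < b"
    using M h D1 \<mu> by (simp add: b_def)
  have b\<omega>_powr: "(b * \<omega> ^ k) powr p = M * h\<^sup>2 / (D1 * \<mu>) * 2 ^ k" for k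
  proof -
    have "(\<omega> ^ k) powr p = (\<omega> powr p) powr real k"
      using \<omega>1 by (simp add: powr_powr mult.commute flip: powr_realpow)
    then have "(\<omega> ^ k) powr p = 2 ^ k"
      by (simp add: \<omega>_powr powr_realpow)
    moreover have "b powr p = M * h\<^sup>2 / (D1 * \<mu>)"
      using M h D1 \<mu> p0 by (simp add: b_def powr_powr)
    ultimately show ?thesis
      using b0 \<omega>1 by (simp add: powr_mult)
  qed
  have b\<omega>_bound: "(b * \<omega> ^ k) powr p \<le> h * 400 powr (- p)" if "k \<le> n" for k
  proof -
    have "2 ^ k \<le> (2 :: real) ^ n"
      using that by (intro power_increasing) auto
    also have "\<dots> \<le> \<rho>0 / T"
      using n(1) T by (simp add: field_simps)
    also have "\<dots> = \<mu> * D1 / (K * h)"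
      using r by (simp add: \<rho>0_def T_def)
    finally have "(b * \<omega> ^ k) powr p \<le> M * h\<^sup>2 / (D1 * \<mu>) * (\<mu> * D1 / (K * h))"
      unfolding b\<omega>_powr using M D1 \<mu> by (intro mult_left_mono) auto
    also have "\<dots> = h * (M / K)"
      using D1 \<mu> h by (simp add: power2_eq_square)
    also have "\<dots> \<le> h * 400 powr (- p)"
      using K0 h by (intro mult_left_mono) (auto simp: powr_minus field_simps)
    finally show ?thesis .
  qed
  have b\<omega>0: "0 < b * \<omega> ^ k" for k
    using b0 \<omega>1 by simp
  have "\<bar>across g u x\<bar> \<le> \<rho>0 / 2 ^ n + 5600 * \<rho>0 * b\<^sup>2 / (1 - \<omega>\<^sup>2 / 2)"
  proof (rule across_le_if_flat_scales[OF u \<rho>0 _ _ \<omega>1 \<omega>2 x(1), where \<eta> = "2 * h * r / D1"])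
    show "0 \<le> b" using b0 by simp
    have "(b * \<omega> ^ n) powr p \<le> 1 * 400 powr (- p)"
      using b\<omega>_bound[of n] h by (intro order_trans[OF _ mult_right_mono[OF h(2)]]) auto
    also have "\<dots> = (1 / 400) powr p"
      by (simp add: powr_minus powr_divide inverse_eq_divide)
    finally have "b * \<omega> ^ n \<le> 1 / 400"
      using powr_less_mono2[OF p0, of "1 / 400" "b * \<omega> ^ n"] by fastforce
    then show "400 * (b * \<omega> ^ n) \<le> 1"
      by simp
    show "\<exists>w\<in>E. s \<le> dist x w \<and> dist x w < s + 2 * h * r / D1" if "0 < s" "s \<le> \<rho>0" for s
      using reach that by (simp add: \<rho>0_def)
    have "24 * (h * r / D1) \<le> K * (h * r / D1)"
      using K0 h r D1 by (intro mult_right_mono) auto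
    then show "12 * (2 * h * r / D1) \<le> \<rho>0 / 2 ^ n"
      using n(1) by (simp add: T_def)
    show "near_line (2 * \<rho>0 * b) g u w" if w: "w \<in> E \<inter> cball x \<rho>0" for w
    proof (rule near_line_mono[OF near])
      have "dist c w \<le> r + \<mu> * r"
        using w x(2) dist_triangle[of c w x] by (simp add: \<rho>0_def)
      also have "\<dots> \<le> D7 * r"
        using mult_right_mono[OF \<mu>(3), of r] r by (simp add: algebra_simps)
      finally show "w \<in> E \<inter> cball c (D7 * r)"
        using w by simp
      have "(2 * \<epsilon> / \<mu>) powr p = (2 / \<mu>) powr p * \<epsilon> powr p"
        using powr_mult[of "2 / \<mu>" \<epsilon> p] \<mu> \<epsilon> by simp
      also have "\<dots> \<le> (2 / \<mu>) powr p * (D * h\<^sup>2 * D7 powr p / D1)"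
        using \<epsilon>(2) D1 by (intro mult_left_mono) (auto simp: field_simps)
      also have "\<dots> = M * h\<^sup>2 / (D1 * 1)"
        by (simp add: M_def)
      also have "\<dots> \<le> M * h\<^sup>2 / (D1 * \<mu>)"
        using M D1 \<mu> by (intro divide_left_mono mult_left_mono) auto
      also have "\<dots> = b powr p"
        using b\<omega>_powr[of 0] by simp
      finally have "2 * \<epsilon> / \<mu> \<le> b"
        using powr_less_mono2[OF p0, of b "2 * \<epsilon> / \<mu>"] b0 by fastforce
      then show "4 * \<epsilon> * r \<le> 2 * \<rho>0 * b"
        using \<mu> r by (simp add: \<rho>0_def field_simps)
    qed
  next
    fix k
    assume k: "k < n" and le: "beta_number E (cball x (\<rho>0 / 2 ^ Suc k)) \<le> 2 * (b * \<omega> ^ k)"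
    define \<rho> where "\<rho> = \<rho>0 / 2 ^ Suc k"
    define \<beta> where "\<beta> = beta_number E (cball x \<rho>)"
    have \<rho>: "0 < \<rho>"
      using \<rho>0 by (simp add: \<rho>_def)
    have \<beta>0: "0 \<le> \<beta>"
      unfolding \<beta>_def using \<rho> by (rule beta_number_nonneg)
    \<comment> \<open>The ball of radius \<rho> / D7 satisfies all requirements on a good ball except possibly the one
    on the excess, which must therefore fail.\<close>
    have "\<beta> powr p \<le> (2 * (b * \<omega> ^ k)) powr p"
      using le p0 \<beta>0 by (intro powr_mono2) (auto simp: \<beta>_def \<rho>_def)
    also have "\<dots> = 2 powr p * (b * \<omega> ^ k) powr p"
      using b\<omega>0[of k] by (simp add: powr_mult)
    also have "\<dots> \<le> 2 powr p * (h * 400 powr (- p))"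
      using b\<omega>_bound[of k] k by (intro mult_left_mono) auto
    also have "\<dots> = (2 powr p / 400 powr p) * h"
      by (simp add: powr_minus divide_inverse)
    also have "\<dots> \<le> 1 * h"
      using p0 h by (intro mult_right_mono) (auto intro: powr_mono2)
    also have "\<dots> \<le> D1 * h"
      using D1 h by (intro mult_right_mono) auto
    finally have \<beta>_le: "\<beta> powr p \<le> D1 * h" .
    have \<rho>n: "\<rho>0 / 2 ^ n \<le> \<rho>"
      unfolding \<rho>_def using k \<rho>0 by (intro divide_left_mono power_increasing) auto
    have D7_\<rho>: "D7 * (\<rho> / D7) = \<rho>"
      using D7 by simp
    have "D1 * beta_number E (cball x (D7 * (\<rho> / D7))) powr p * (D7 * (\<rho> / D7)) < D * h\<^sup>2 * r"
    proof (rule no_good_ball)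
      show "0 < \<rho> / D7"
        using \<rho> D7 by simp
      have "D7 * (h * r / D1) \<le> K * (h * r / D1)"
        using K0 h r D1 by (intro mult_right_mono) auto
      then have "D7 * (h * r / D1) \<le> \<rho>"
        using n(1) \<rho>n by (simp add: T_def)
      then show "h * r / D1 \<le> \<rho> / D7"
        using D7 by (simp add: field_simps)
      have "\<rho> / D7 \<le> \<rho>"
        using D7 \<rho> by (simp add: field_simps)
      also have "\<rho> \<le> \<rho>0 / 1"
        unfolding \<rho>_def using \<rho>0 by (intro divide_left_mono one_le_power) auto
      also have "\<rho>0 / 1 \<le> D7 * r - r"
        using mult_right_mono[OF \<mu>(3), of r] r by (simp add: \<rho>0_def algebra_simps)
      finally have small: "\<rho> / D7 \<le> D7 * r - r" .
      show "cball x (\<rho> / D7) \<subseteq> cball c (16 * D7 * r)"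
      proof
        fix w assume "w \<in> cball x (\<rho> / D7)"
        then have "dist c w \<le> D7 * r"
          using small x(2) dist_triangle[of c w x] by simp
        also have "\<dots> \<le> 16 * D7 * r"
          using D7 r by simp
        finally show "w \<in> cball c (16 * D7 * r)"
          by simp
      qed
      show "beta_number E (cball x (D7 * (\<rho> / D7))) powr p \<le> D1 * h"
        using \<beta>_le unfolding D7_\<rho> \<beta>_def .
    qed
    then have "D1 * \<beta> powr p * \<rho> < D * h\<^sup>2 * r"
      unfolding D7_\<rho> \<beta>_def .
    then have "\<beta> powr p < D * h\<^sup>2 * r / (D1 * \<rho>)"
      using D1 \<rho> by (simp add: less_divide_eq mult_ac)
    also have "\<dots> = D * h\<^sup>2 / (D1 * \<mu>) * 2 ^ Suc k"
      using r by (simp add: \<rho>_def \<rho>0_def)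
    also have "\<dots> \<le> (b * \<omega> ^ Suc k) powr p"
      unfolding b\<omega>_powr using M D1 \<mu> by (intro mult_right_mono divide_right_mono) auto
    finally have "\<not> b * \<omega> ^ Suc k \<le> \<beta>"
      using powr_mono2[of p "b * \<omega> ^ Suc k" \<beta>] p0 b\<omega>0[of "Suc k"] by auto
    then show "beta_number E (cball x (\<rho>0 / 2 ^ Suc k)) < b * \<omega> ^ Suc k"
      by (simp add: \<beta>_def \<rho>_def)
  qed
  also have "\<dots> \<le> (2 * K / D1) * h * r + 5600 / (1 - \<omega>\<^sup>2 / 2) * (M / \<mu> / D1) powr (2 / p) * h * r"
  proof (rule add_mono)
    show "\<rho>0 / 2 ^ n \<le> (2 * K / D1) * h * r"
      using n(2) by (simp add: T_def)
    have "b\<^sup>2 = (M / \<mu> / D1 * h powr 2) powr (2 / p)"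
      using h M D1 \<mu> by (simp add: b_def powr_power mult.commute)
    also have "\<dots> = (M / \<mu> / D1) powr (2 / p) * (h powr 2) powr (2 / p)"
      by (rule powr_mult)
    also have "(h powr 2) powr (2 / p) = h powr (4 / p)"
      by (simp only: powr_powr) simp
    finally have b2: "b\<^sup>2 = (M / \<mu> / D1) powr (2 / p) * h powr (4 / p)" .
    have "h powr (4 / p) \<le> h powr 1"
      using h p p4 by (intro powr_mono') auto
    then have "b\<^sup>2 \<le> (M / \<mu> / D1) powr (2 / p) * h"
      unfolding b2 using h by (intro mult_left_mono) auto
    then have "5600 * r / (1 - \<omega>\<^sup>2 / 2) * (\<mu> * b\<^sup>2)
        \<le> 5600 * r / (1 - \<omega>\<^sup>2 / 2) * (1 * ((M / \<mu> / D1) powr (2 / p) * h))"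
      using \<mu> r \<omega>2 by (intro mult_left_mono mult_mono) auto
    then show "5600 * \<rho>0 * b\<^sup>2 / (1 - \<omega>\<^sup>2 / 2)
        \<le> 5600 / (1 - \<omega>\<^sup>2 / 2) * (M / \<mu> / D1) powr (2 / p) * h * r"
      by (simp add: \<rho>0_def mult_ac)
  qed
  finally show ?thesis
    by (simp add: \<omega>_def algebra_simps)
qed

section \<open>Existence of a good ball\<close>

theorem proposition4p1:
  fixes D_FFP :: "real \<Rightarrow> real \<Rightarrow> real"
    and p \<alpha>1 \<alpha>2 D7 D :: real
  assumes "\<And>a1 a2. 0 < a1 \<Longrightarrow> a1 < a2 \<Longrightarrow> a2 < 1 \<Longrightarrow> FFP_constant a1 a2 (D_FFP a1 a2)"
    and "p < 4" and "0 < \<alpha>1" and "\<alpha>1 < \<alpha>2" and "\<alpha>2 < 1" and "D7 > 1"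
    and "D = D_FFP (\<alpha>1 / D7) (\<alpha>2 / D7)"
  shows "\<exists>D1 \<epsilon>1. D1 > 0 \<and> 0 < \<epsilon>1 \<and> \<epsilon>1 < 1 \<and>
    (\<forall>c r E \<epsilon> q p1 p2 p3.
      r > 0 \<longrightarrow>
      beta_number E (cball c (D7 * r)) = \<epsilon> / D7 \<longrightarrow>
      \<epsilon> / D7 \<le> \<epsilon>1 \<longrightarrow>
      {p1, p2, p3} \<subseteq> E \<inter> cball c r \<longrightarrow>
      distances_between (\<alpha>1 * diameter (cball c r)) (\<alpha>2 * diameter (cball c r)) p1 p2 p3 \<longrightarrow>
      2 \<le> q \<longrightarrow> q < p \<longrightarrow>
      triangle_excess p1 p2 p3 = D * \<epsilon> powr q * diameter (cball c r) \<longrightarrow>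
      D * \<epsilon> powr q * diameter (cball c r) > D * \<epsilon> powr p * diameter (cball c r) \<longrightarrow>
      (\<forall>c' r'. r' > 0 \<longrightarrow>
        cball c' r' \<subseteq> cball c (4 * D7 * r) \<longrightarrow>
        diameter (cball c' r') \<ge> 1 / D1 * \<epsilon> powr (q / 2) * diameter (cball c r) \<longrightarrow>
        delta_connected_in (1 / D1 * \<epsilon> powr (q / 2) * diameter (cball c r))
          (E \<inter> cball c' r') (E \<inter> cball c' (D7 * r'))) \<longrightarrow>
      (\<exists>c'' r''. r'' > 0 \<and>
        cball c'' r'' \<subseteq> cball c (16 * D7 * r) \<and>
        diameter (cball c'' r'') \<ge> 1 / D1 * \<epsilon> powr (q / 2) * diameter (cball c r) \<and>
        triangle_excess p1 p2 p3
          \<le> D1 * beta_number E (cball c'' (D7 * r'')) powr p * diameter (cball c'' (D7 * r'')) \<and>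
        beta_number E (cball c'' (D7 * r'')) powr p \<le> D1 * \<epsilon> powr (q / 2)))"
proof (cases "2 < p")
  case False
  then show ?thesis
    by (intro exI[of _ 1] exI[of _ "1 / 2"]) auto
next
  case p2: True
  have "0 < \<alpha>1 / D7" "\<alpha>1 / D7 < \<alpha>2 / D7" "\<alpha>2 / D7 < 1"
    using assms by (simp_all add: divide_strict_right_mono divide_less_eq)
  then have D: "0 < D"
    using assms(1,7) unfolding FFP_constant_def by blast
  define \<alpha> where "\<alpha> = \<alpha>1"
  have \<alpha>: "0 < \<alpha>" "\<alpha> < 1"
    using assms by (auto simp: \<alpha>_def)
  have D7: "1 < D7" and p4: "p < 4"
    using assms by auto
  define \<mu> where "\<mu> = min (D7 - 1) \<alpha>"
  have \<mu>: "0 < \<mu>" "\<mu> \<le> 1" "\<mu> \<le> D7 - 1" "\<mu> \<le> \<alpha>"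
    using D7 \<alpha> by (auto simp: \<mu>_def)
  define M where "M = D * D7 powr p * (2 / \<mu>) powr p"
  define K where "K = 24 + D7 + M * 400 powr p"
  \<comment> \<open>If the points deviate by at most \<kappa> h r in the plane, then the planar part of the
    excess stays below 5/6 D h^2 r; the goal is to contradict its value 2 D h^2 r.\<close>
  define \<kappa> where "\<kappa> = min (\<alpha> / 8) (D / 3)"
  define S where "S = 5600 / (1 - (2 powr (1 / p))\<^sup>2 / 2)"
  have M: "0 < M"
    using D D7 \<mu> by (simp add: M_def)
  have K: "0 < K"
    using M D7 by (auto simp: K_def intro!: add_pos_pos)
  have \<kappa>: "0 < \<kappa>" "\<kappa> \<le> \<alpha> / 8" "\<kappa> \<le> D / 3"
    using \<alpha> D by (auto simp: \<kappa>_def)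
  obtain D1 where D1: "1 \<le> D1" "K / \<mu> \<le> D1" "2 * K / D1 + S * (M / \<mu> / D1) powr (2 / p) \<le> \<kappa>"
    using exists_large_constant[of \<kappa> "2 / p" "M / \<mu>" "K / \<mu>" "2 * K" S] \<kappa> p2 M \<mu> by auto
  obtain e where e: "0 < e" "e < 1" "32 * e \<le> \<alpha>" "2 * D * e \<le> \<alpha>"
    and e_powr: "e powr (4 - p) \<le> D * \<alpha> ^ 3 / 9216"
    using exists_small_bound[of "4 - p" "min (\<alpha> / 32) (\<alpha> / (2 * D))" "D * \<alpha> ^ 3 / 9216"] p4 \<alpha> D
    by (auto simp: field_simps)
  show ?thesis
  proof (rule exI[of _ D1], rule exI[of _ "e / D7"], intro conjI allI impI)
    show "0 < D1" "0 < e / D7" "e / D7 < 1"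
      using D1 e D7 by (auto simp: divide_less_eq)
    fix c r E \<epsilon> q p1 p2 p3
    assume r: "0 < r"
      and \<beta>: "beta_number E (cball c (D7 * r)) = \<epsilon> / D7" "\<epsilon> / D7 \<le> e / D7"
      and pts: "{p1, p2, p3} \<subseteq> E \<inter> cball c r"
      and dists: "distances_between (\<alpha>1 * diameter (cball c r)) (\<alpha>2 * diameter (cball c r)) p1 p2 p3"
      and q: "2 \<le> q" "q < p"
      and excess: "triangle_excess p1 p2 p3 = D * \<epsilon> powr q * diameter (cball c r)"
      and gap: "D * \<epsilon> powr q * diameter (cball c r) > D * \<epsilon> powr p * diameter (cball c r)"
      and conn: "\<forall>c' r'. r' > 0 \<longrightarrow>
        cball c' r' \<subseteq> cball c (4 * D7 * r) \<longrightarrow>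
        diameter (cball c' r') \<ge> 1 / D1 * \<epsilon> powr (q / 2) * diameter (cball c r) \<longrightarrow>
        delta_connected_in (1 / D1 * \<epsilon> powr (q / 2) * diameter (cball c r))
          (E \<inter> cball c' r') (E \<inter> cball c' (D7 * r'))"
    define h where "h = \<epsilon> powr (q / 2)"
    have diam: "diameter (cball c' s) = 2 * s" if "0 < s" for c' :: heis and s
      using that by (simp add: diameter_cball_heis)
    have "0 \<le> \<epsilon> / D7"
      using beta_number_nonneg[of "D7 * r" E c] \<beta>(1) r D7 by simp
    moreover have "\<epsilon> \<noteq> 0"
      using gap by auto
    ultimately have \<epsilon>: "0 < \<epsilon>" "\<epsilon> \<le> e"
      using \<beta>(2) D7 by (auto simp: divide_le_cancel zero_le_divide_iff)
    have h_sq: "h\<^sup>2 = \<epsilon> powr q"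
      using \<epsilon>(1) by (simp add: h_def powr_power)
    have "\<epsilon> powr (q / 2) \<le> \<epsilon> powr 1"
      using q \<epsilon> e by (intro powr_mono') auto
    then have h: "0 < h" "h \<le> \<epsilon>" "h \<le> 1"
      using \<epsilon> e by (auto simp: h_def)
    have excess': "triangle_excess p1 p2 p3 = 2 * (D * h\<^sup>2 * r)"
      using excess r by (simp add: diam h_sq)
    have far: "2 * (\<alpha> * r) \<le> dist p1 p2" "2 * (\<alpha> * r) \<le> dist p2 p3" "2 * (\<alpha> * r) \<le> dist p1 p3"
      using dists r by (auto simp: distances_between_def diam \<alpha>_def)
    show "\<exists>c'' r''. r'' > 0 \<and>
        cball c'' r'' \<subseteq> cball c (16 * D7 * r) \<and>
        diameter (cball c'' r'') \<ge> 1 / D1 * \<epsilon> powr (q / 2) * diameter (cball c r) \<and>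
        triangle_excess p1 p2 p3
          \<le> D1 * beta_number E (cball c'' (D7 * r'')) powr p * diameter (cball c'' (D7 * r'')) \<and>
        beta_number E (cball c'' (D7 * r'')) powr p \<le> D1 * \<epsilon> powr (q / 2)" (is ?goal)
    proof (rule ccontr)
      assume contra: "\<not> ?goal"
      have no_good_ball: "D1 * beta_number E (cball c' (D7 * s)) powr p * (D7 * s) < D * h\<^sup>2 * r"
        if "0 < s" "cball c' s \<subseteq> cball c (16 * D7 * r)" "h * r / D1 \<le> s"
          "beta_number E (cball c' (D7 * s)) powr p \<le> D1 * h" for c' s
      proof (rule ccontr)
        assume "\<not> ?thesis"
        moreover have "0 < D7 * s"
          using that D7 by simp
        ultimately have le: "triangle_excess p1 p2 p3
            \<le> D1 * beta_number E (cball c' (D7 * s)) powr p * diameter (cball c' (D7 * s))"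
          unfolding excess' diam[OF \<open>0 < D7 * s\<close>] by linarith
        have "1 / D1 * \<epsilon> powr (q / 2) * diameter (cball c r) = 2 * (h * r / D1)"
          by (simp add: diam[OF r] h_def mult_ac)
        also have "\<dots> \<le> diameter (cball c' s)"
          using that by (simp add: diam)
        finally have "?goal"
          using that le unfolding h_def by blast
        with contra show False ..
      qed
      \<comment> \<open>That B itself is not good makes \<epsilon>^p small compared with \<epsilon>^q, by a factor of the order of 1 / D1.
        This starts the descent, although q may be arbitrarily close to p.\<close>
      have "D1 * (\<epsilon> / D7) powr p * (D7 * r) < D * h\<^sup>2 * r"
      proof (rule no_good_ball[OF r, of c, unfolded \<beta>(1)])
        have "r \<le> 16 * D7 * r"
          using D7 r by simp
        then show "cball c r \<subseteq> cball c (16 * D7 * r)"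
          by (rule subset_cball)
        have "h \<le> D1"
          using h D1 by linarith
        then show "h * r / D1 \<le> r"
          using r D1 by (simp add: divide_le_eq mult.commute)
        have "\<epsilon> / D7 \<le> \<epsilon>"
          using \<epsilon> D7 by (simp add: divide_le_eq)
        then have "(\<epsilon> / D7) powr p \<le> \<epsilon> powr p"
          using \<epsilon> D7 p2 by (intro powr_mono2) auto
        also have "\<dots> \<le> \<epsilon> powr (q / 2)"
          using \<epsilon> e q by (intro powr_mono') auto
        also have "\<dots> \<le> D1 * h"
          using D1 h mult_right_mono[OF D1(1), of h] by (simp add: h_def)
        finally show "(\<epsilon> / D7) powr p \<le> D1 * h" .
      qed
      then have "D1 * (\<epsilon> powr p / D7 powr p) * D7 * r < D * h\<^sup>2 * r"
        by (simp add: powr_divide mult_ac)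
      then have "D1 * (\<epsilon> powr p / D7 powr p) * D7 < D * h\<^sup>2"
        using r by (simp only: mult_less_cancel_right_pos)
      moreover have "D1 * (\<epsilon> powr p / D7 powr p) * 1 \<le> D1 * (\<epsilon> powr p / D7 powr p) * D7"
        using D1 D7 by (intro mult_left_mono) auto
      ultimately have "D1 * \<epsilon> powr p / D7 powr p < D * h\<^sup>2"
        by simp
      then have \<epsilon>_small: "D1 * \<epsilon> powr p < D * h\<^sup>2 * D7 powr p"
        using D7 by (simp add: divide_less_eq)
      have "beta_number E (cball c (D7 * r)) < 2 * \<epsilon> / D7"
        using \<beta>(1) \<epsilon> D7 by (simp add: divide_strict_right_mono)
      moreover have "0 < D7 * r"
        using r D7 by simp
      ultimately obtain g u where u: "unit_direction u"
        and "\<And>w. w \<in> E \<inter> cball c (D7 * r) \<Longrightarrow> near_line (2 * (D7 * r) * (2 * \<epsilon> / D7)) g u w"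
        using beta_number_less_obtain_line by metis
      then have near: "\<And>w. w \<in> E \<inter> cball c (D7 * r) \<Longrightarrow> near_line (4 * \<epsilon> * r) g u w"
        using D7 by (simp add: mult_ac)
      have "delta_connected_in (2 * h * r / D1) (E \<inter> cball c r) (E \<inter> cball c (D7 * r))"
      proof -
        have "h \<le> D1"
          using h D1 by linarith
        then have "1 / D1 * \<epsilon> powr (q / 2) * diameter (cball c r) \<le> diameter (cball c r)"
          using r D1 by (simp add: diam h_def[symmetric] divide_le_eq)
        moreover have "cball c r \<subseteq> cball c (4 * D7 * r)"
          using D7 r by (intro subset_cball) simp
        ultimately have "delta_connected_in (1 / D1 * \<epsilon> powr (q / 2) * diameter (cball c r))
            (E \<inter> cball c r) (E \<inter> cball c (D7 * r))"
          using conn r by blast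
        then show ?thesis
          using r by (simp add: diam h_def mult_ac)
      qed
      note reach = connected_point_at_distance[OF this]
      have across: "\<bar>across g u x\<bar> \<le> \<kappa> * h * r" if x: "x \<in> {p1, p2, p3}" for x
      proof -
        obtain y where y: "y \<in> E \<inter> cball c r" "2 * (\<alpha> * r) \<le> dist x y"
          using x pts far by (metis dist_commute insert_iff insert_subset singletonD)
        have xE: "x \<in> E \<inter> cball c r"
          using x pts by auto
        have "\<bar>across g u x\<bar> \<le> (2 * K / D1 + S * (M / \<mu> / D1) powr (2 / p)) * h * r"
          unfolding K_def M_def S_def
        proof (rule across_le_if_no_good_ball[OF p2 _ D D7 D1(1) r \<mu>(1-3) h(1,3) _ _ _ _ \<epsilon>(1) \<epsilon>_small u near])
          show "p \<le> 4" "x \<in> E" "dist c x \<le> r"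
            using p4 xE by auto
          show "(24 + D7 + D * D7 powr p * (2 / \<mu>) powr p * 400 powr p) / \<mu> \<le> D1"
            using D1(2) by (simp add: K_def M_def)
          fix s assume s: "0 < s" "s \<le> \<mu> * r"
          have "s \<le> \<alpha> * r"
            using s(2) mult_right_mono[OF \<mu>(4), of r] r by linarith
          then have "s \<le> dist x y"
            using y(2) \<alpha> r mult_pos_pos[of \<alpha> r] by linarith
          then show "\<exists>w\<in>E. s \<le> dist x w \<and> dist x w < s + 2 * h * r / D1"
            using reach[OF xE y(1) s(1)] by blast
        qed (assumption, rule no_good_ball)
        also have "\<dots> \<le> \<kappa> * h * r"
          using D1(3) h r by (intro mult_right_mono) auto
        finally show ?thesis .
      qed
      define a where "a = \<alpha> * r"
      define err where "err = 10 * (\<kappa> * h * r)\<^sup>2 / a + 18 * (4 * \<epsilon> * r) ^ 4 / a ^ 3"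
      have a: "0 < a"
        using \<alpha> r by (simp add: a_def)
      have "err < D * h\<^sup>2 * r"
      proof -
        have "10 * (\<kappa> * h * r)\<^sup>2 / a = 10 * \<kappa>\<^sup>2 / \<alpha> * (h\<^sup>2 * r)"
          using r by (simp add: a_def power_mult_distrib power2_eq_square)
        also have "\<dots> \<le> 5 * D / 12 * (h\<^sup>2 * r)"
        proof (rule mult_right_mono)
          have "\<kappa>\<^sup>2 \<le> \<alpha> / 8 * (D / 3)"
            unfolding power2_eq_square using \<kappa> \<alpha> by (intro mult_mono) auto
          then show "10 * \<kappa>\<^sup>2 / \<alpha> \<le> 5 * D / 12"
            using \<alpha> by (simp add: field_simps)
        qed (use r in auto)
        finally have 1: "10 * (\<kappa> * h * r)\<^sup>2 / a \<le> 5 / 12 * (D * h\<^sup>2 * r)"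
          by simp
        have "\<epsilon> ^ 4 = \<epsilon> powr (4 - q) * h\<^sup>2"
          using \<epsilon> by (simp add: h_sq flip: powr_add)
        also have "\<dots> \<le> e powr (4 - p) * h\<^sup>2"
        proof (rule mult_right_mono)
          have "\<epsilon> powr (4 - q) \<le> \<epsilon> powr (4 - p)"
            using \<epsilon> e q by (intro powr_mono') auto
          also have "\<dots> \<le> e powr (4 - p)"
            using \<epsilon> p4 by (intro powr_mono2) auto
          finally show "\<epsilon> powr (4 - q) \<le> e powr (4 - p)" .
        qed auto
        also have "\<dots> \<le> D * \<alpha> ^ 3 / 9216 * h\<^sup>2"
          using e_powr by (intro mult_right_mono) auto
        finally have \<epsilon>4: "\<epsilon> ^ 4 \<le> D * \<alpha> ^ 3 / 9216 * h\<^sup>2" .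
        have "18 * (4 * \<epsilon> * r) ^ 4 / a ^ 3 = 4608 / \<alpha> ^ 3 * r * \<epsilon> ^ 4"
          using r by (simp add: a_def power_mult_distrib eval_nat_numeral)
        also have "\<dots> \<le> 4608 / \<alpha> ^ 3 * r * (D * \<alpha> ^ 3 / 9216 * h\<^sup>2)"
          using \<epsilon>4 \<alpha> r by (intro mult_left_mono) auto
        also have "\<dots> = 1 / 2 * (D * h\<^sup>2 * r)"
          using \<alpha> by simp
        finally have 2: "18 * (4 * \<epsilon> * r) ^ 4 / a ^ 3 \<le> 1 / 2 * (D * h\<^sup>2 * r)" .
        have "0 < D * h\<^sup>2 * r"
          using D h r by simp
        then show ?thesis
          using 1 2 unfolding err_def by linarith
      qed
      moreover have "triangle_excess p1 p2 p3 \<le> 2 * err"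
        unfolding err_def
      proof (rule triangle_excess_near_line[OF u a _ _ _ across far[folded a_def]])
        have "\<kappa> * h \<le> \<alpha> / 8 * 1"
          using \<kappa> h \<alpha> by (intro mult_mono) auto
        then show "8 * (\<kappa> * h * r) \<le> a"
          using mult_right_mono[of "\<kappa> * h" "\<alpha> / 8" r] r by (simp add: a_def)
        show "8 * (4 * \<epsilon> * r) \<le> a"
          using mult_right_mono[of "32 * \<epsilon>" \<alpha> r] e \<epsilon> r by (simp add: a_def)
        show "near_line (4 * \<epsilon> * r) g u w" if "w \<in> {p1, p2, p3}" for w
        proof (rule near)
          have "r \<le> D7 * r"
            using D7 r by simp
          then show "w \<in> E \<inter> cball c (D7 * r)"
            using that pts by auto
        qed
        have "h\<^sup>2 \<le> \<epsilon> * 1"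
          unfolding power2_eq_square using h \<epsilon> by (intro mult_mono) auto
        then have "2 * D * h\<^sup>2 \<le> 2 * D * e"
          using D \<epsilon> by (intro mult_left_mono) auto
        then have "2 * D * h\<^sup>2 * r \<le> \<alpha> * r"
          using e r by (intro mult_right_mono) auto
        then show "triangle_excess p1 p2 p3 + (10 * (\<kappa> * h * r)\<^sup>2 / a + 18 * (4 * \<epsilon> * r) ^ 4 / a ^ 3) < 2 * a"
          unfolding excess' err_def[symmetric]
          using \<open>err < D * h\<^sup>2 * r\<close> a a_def by linarith
      qed
      ultimately show False
        using excess' by simp
    qed
  qed
qed

end
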